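(* Let $G=(T_1,T_2,S,E,\mathbf{M}_1,\mathbf{M}_2)$ be an instance of the basic path-matching problem with $\mathbf{M}_1,\mathbf{M}_2$ linear and represented by matrices $Q_1,Q_2$ over a common field $\mathbb{F}$ as described in the context. Let $M\subseteq E$ be a set of edges such that $\partial_1 M$ is independent in $\mathbf{M}_1$ and $\partial_2 M$ is independent in $\mathbf{M}_2$. Then the contracted instance $G(M)$ has a basic path-matching if and only if the matrix $Z(M)$ is non-singular (over the field of rational functions over $\mathbb{F}$ in all the indeterminates occurring in $Z(M)$).
   Context: Instance: $(T_1\cup T_2\cup S,E)$ is a graph with $T_1,T_2,S$ pairwise disjoint, $T_1,T_2$ stable sets (no edge with both endpoints in $T_1$, nor in $T_2$), $|T_1|=|T_2|=t$; $\mathbf{M}_i$ is a matroid on ground set $T_i$ with independent sets $\mathcal{I}_i$, and both have rank $r$. $Q_1$ is an $r\times t$ matrix over $\mathbb{F}$ whose columns, indexed by $T_1$, represent $\mathbf{M}_1$; $Q_2$ is a $t\times r$ matrix over $\mathbb{F}$ whose rows, indexed by $T_2$, represent $\mathbf{M}_2$. For $J\subseteq T_1$ write $Q_1^J=Q_1[*,J]$ (columns in $J$), and for $J\subseteq T_2$ write $Q_2^J=Q_2[J,*]$ (rows in $J$). A path-matching is a set of edges consisting of a collection of vertex-disjoint paths each with one endpoint in $T_1$ and the other in $T_2$, together with a matching on the $S$-vertices not in any of the paths. For $M\subseteq E$, $\partial_i M\subseteq T_i$ is the set of vertices of $T_i$ covered by $M$ and $\partial_S M$ the set of covered vertices of $S$.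 A basic path-matching (bpm) is a path-matching $M$ with $\partial_i M$ a basis of $\mathbf{M}_i$ ($i=1,2$) and $\partial_S M=S$ (the same notions apply to any instance of this form). Contraction: for $M\subseteq E$ let $\overline{\partial_i M}=T_i\setminus\partial_i M$; let $P_i$ be the set of paths in $M$ with one endpoint in $T_i$ and the other in $S$, and let $C_i\subseteq S$ be the set of endpoints in $S$ of the paths in $P_i$. Set $T_i'=\overline{\partial_i M}\cup C_i$, $S'=S\setminus\partial_S M$, let $E'\subseteq E$ be the set of edges with both endpoints in $S'$, or with one endpoint in $T_i'$ and the other in $S'\cup T_j'$ where $\{i,j\}=\{1,2\}$, and let $\mathbf{M}_i'=(\mathbf{M}_i/\partial_i M)\oplus \mathbf{F}(C_i)$, the direct sum of the contraction of $\mathbf{M}_i$ by $\partial_i M$ with the free matroid on $C_i$ (in which $C_i$ is the unique basis). Then $G(M)=(T_1',T_2',S',E',\mathbf{M}_1',\mathbf{M}_2')$. Matrices: $X$ has rows indexed by $T_1\cup S$ and columns indexed by $T_2\cup S$, with $X_{a,b}=\pm x_{\{a,b\}}$ if $\{a,b\}\in E$ (a distinct indeterminate for each edge) and $X_{a,b}=0$ otherwise, the signs chosen so that $X[S,S]$ is skew-symmetric. $D_1$ (resp. $D_2$) is a diagonal matrix with rows and columns indexed by $\overline{\partial_1 M}$ (resp. $\overline{\partial_2 M}$) whose diagonal entries are distinct new indeterminates. Then $$Z(M)=\begin{pmatrix} 0 & Q_1^{\partial_1 M} & Q_1^{\overline{\partial_1 M}} & 0 & 0\\ Q_2^{\partial_2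 M} & 0 & 0 & 0 & 0\\ Q_2^{\overline{\partial_2 M}} & 0 & 0 & D_2 & 0\\ 0 & 0 & D_1 & X[\overline{\partial_1 M},\overline{\partial_2 M}] & X[\overline{\partial_1 M},C_2\cup S']\\ 0 & 0 & 0 & X[C_1\cup S',\overline{\partial_2 M}] & X[C_1\cup S',C_2\cup S'] \end{pmatrix},$$ where the first row block has $r$ rows and the first column block has $r$ columns. *)

theory Defs
  imports
    "HOL-Library.Disjoint_Sets"
    "HOL-Library.Poly_Mapping"
    "HOL-Computational_Algebra.Fraction_Field"
    "Jordan_Normal_Form.Matrix"
begin

section \<open>Matroids\<close>

record 'v matroid =
  ground :: "'v set"
  indep :: "'v set set"

definition is_matroid :: "'v matroid \<Rightarrow> bool" where
  "is_matroid A \<longleftrightarrow>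
     finite (ground A) \<and> (\<forall>I \<in> indep A. I \<subseteq> ground A) \<and> {} \<in> indep A \<and>
     (\<forall>I \<in> indep A. \<forall>J. J \<subseteq> I \<longrightarrow> J \<in> indep A) \<and>
     (\<forall>I \<in> indep A. \<forall>J \<in> indep A. card I < card J \<longrightarrow>
        (\<exists>e \<in> J - I. insert e I \<in> indep A))"

text \<open>A basis of a subset \<open>W\<close> of the ground set is a maximal independent subset of \<open>W\<close>.\<close>

definition basis_in :: "'v matroid \<Rightarrow> 'v set \<Rightarrow> 'v set \<Rightarrow> bool" where
  "basis_in A W B \<longleftrightarrow>
     B \<in> indep A \<and> B \<subseteq> W \<and> (\<forall>J \<in> indep A. B \<subseteq> J \<and> J \<subseteq> W \<longrightarrow> J = B)"

definition matroid_basis :: "'v matroid \<Rightarrow> 'v set \<Rightarrow> bool" where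
  "matroid_basis A B \<longleftrightarrow> basis_in A (ground A) B"

definition matroid_rank :: "'v matroid \<Rightarrow> nat" where
  "matroid_rank A = Max (card ` indep A)"

definition matroid_contract :: "'v matroid \<Rightarrow> 'v set \<Rightarrow> 'v matroid" where
  "matroid_contract A W =
     \<lparr>ground = ground A - W,
      indep = {J. J \<subseteq> ground A - W \<and> (\<exists>B. basis_in A W B \<and> J \<union> B \<in> indep A)}\<rparr>"

definition free_matroid :: "'v set \<Rightarrow> 'v matroid" where
  "free_matroid C = \<lparr>ground = C, indep = Pow C\<rparr>"

text \<open>Meant for matroids on disjoint ground sets.\<close>

definition direct_sum :: "'v matroid \<Rightarrow> 'v matroid \<Rightarrow> 'v matroid" where
  "direct_sum A B =
     \<lparr>ground = ground A \<union> ground B, indep = {I \<union> J | I J. I \<in> indep A \<and> J \<in> indep B}\<rparr>"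

text \<open>The family of vectors \<open>(v j)\<close>, \<open>j \<in> J\<close>, of length \<open>r\<close>; as a family, so that repeated
  vectors are dependent.\<close>

definition lin_indep_family :: "nat \<Rightarrow> 'v set \<Rightarrow> ('v \<Rightarrow> nat \<Rightarrow> 'f::field) \<Rightarrow> bool" where
  "lin_indep_family r J v \<longleftrightarrow>
     (\<forall>c. (\<forall>i<r. (\<Sum>j\<in>J. c j * v j i) = 0) \<longrightarrow> (\<forall>j\<in>J. c j = 0))"

definition represents :: "nat \<Rightarrow> ('v \<Rightarrow> nat \<Rightarrow> 'f::field) \<Rightarrow> 'v matroid \<Rightarrow> bool" where
  "represents r v A \<longleftrightarrow> (\<forall>J. J \<subseteq> ground A \<longrightarrow> (J \<in> indep A \<longleftrightarrow> lin_indep_family r J v))"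


section \<open>Basic path-matchings\<close>

text \<open>Edges of simple graphs are two-element sets of vertices.\<close>

record 'v bpm_inst =
  T1 :: "'v set"
  T2 :: "'v set"
  SS :: "'v set"
  EE :: "'v set set"
  MM1 :: "'v matroid"
  MM2 :: "'v matroid"

definition bpm_instance :: "nat \<Rightarrow> nat \<Rightarrow> 'v bpm_inst \<Rightarrow> bool" where
  "bpm_instance t r G \<longleftrightarrow>
     finite (T1 G) \<and> finite (T2 G) \<and> finite (SS G) \<and>
     T1 G \<inter> T2 G = {} \<and> T1 G \<inter> SS G = {} \<and> T2 G \<inter> SS G = {} \<and>
     (\<forall>e \<in> EE G. e \<subseteq> T1 G \<union> T2 G \<union> SS G \<and> card e = 2) \<and>
     (\<forall>e \<in> EE G. \<not> e \<subseteq> T1 G \<and> \<not> e \<subseteq> T2 G) \<and>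
     card (T1 G) = t \<and> card (T2 G) = t \<and>
     is_matroid (MM1 G) \<and> ground (MM1 G) = T1 G \<and> matroid_rank (MM1 G) = r \<and>
     is_matroid (MM2 G) \<and> ground (MM2 G) = T2 G \<and> matroid_rank (MM2 G) = r"

text \<open>Paths are given by their vertex sequences.\<close>

definition path_edges :: "'v list \<Rightarrow> 'v set set" where
  "path_edges p = {{p ! i, p ! Suc i} | i. Suc i < length p}"

definition is_path :: "'v set set \<Rightarrow> 'v list \<Rightarrow> bool" where
  "is_path F p \<longleftrightarrow> p \<noteq> [] \<and> distinct p \<and> path_edges p \<subseteq> F"

text \<open>\<open>covered W M\<close> is the set of vertices in \<open>W\<close> covered by \<open>M\<close>, that is, \<open>\<partial>\<^sub>i M\<close> for
  \<open>W = T\<^sub>i\<close> and \<open>\<partial>\<^sub>S M\<close> for \<open>W = S\<close>.\<close>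

definition covered :: "'v set \<Rightarrow> 'v set set \<Rightarrow> 'v set" where
  "covered W M = {v \<in> W. \<exists>e \<in> M. v \<in> e}"

text \<open>As usual for path-matchings, the inner vertices of the paths belong to \<open>S\<close>.\<close>

definition path_matching :: "'v bpm_inst \<Rightarrow> 'v set set \<Rightarrow> bool" where
  "path_matching G M \<longleftrightarrow>
     (\<exists>P N. (\<forall>p \<in> P. is_path (EE G) p \<and> hd p \<in> T1 G \<and> last p \<in> T2 G \<and>
                    set (butlast (tl p)) \<subseteq> SS G) \<and>
            disjoint_family_on set P \<and>
            N \<subseteq> EE G \<and> disjoint N \<and> (\<forall>e \<in> N. e \<subseteq> SS G - (\<Union>p\<in>P. set p)) \<and>
            M = (\<Union>p\<in>P. path_edges p) \<union> N)"

definition bpm :: "'v bpm_inst \<Rightarrow> 'v set set \<Rightarrow> bool" where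
  "bpm G M \<longleftrightarrow>
     path_matching G M \<and>
     matroid_basis (MM1 G) (covered (T1 G) M) \<and>
     matroid_basis (MM2 G) (covered (T2 G) M) \<and>
     covered (SS G) M = SS G"


section \<open>Contraction\<close>

text \<open>The paths in an edge set \<open>M\<close> are the connected components of \<open>M\<close> that are paths: \<open>M\<close> has
  no further edges at the vertices of such a path.\<close>

definition path_component :: "'v set set \<Rightarrow> 'v list \<Rightarrow> bool" where
  "path_component M p \<longleftrightarrow> is_path M p \<and> {e \<in> M. e \<inter> set p \<noteq> {}} = path_edges p"

text \<open>\<open>C\<^sub>i\<close> for \<open>T = T\<^sub>i\<close>: paths may be traversed in both directions, so it suffices to consider
  those starting in \<open>T\<close> and ending in \<open>S\<close>.\<close>

definition path_ends :: "'v set \<Rightarrow> 'v set \<Rightarrow> 'v set set \<Rightarrow> 'v set" where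
  "path_ends T S M = {last p | p. path_component M p \<and> hd p \<in> T \<and> last p \<in> S}"

context
  fixes G :: "'v bpm_inst" and M :: "'v set set"
begin

definition cov1 :: "'v set" where "cov1 = covered (T1 G) M"
definition cov2 :: "'v set" where "cov2 = covered (T2 G) M"
definition unc1 :: "'v set" where "unc1 = T1 G - cov1"
definition unc2 :: "'v set" where "unc2 = T2 G - cov2"
definition C1 :: "'v set" where "C1 = path_ends (T1 G) (SS G) M"
definition C2 :: "'v set" where "C2 = path_ends (T2 G) (SS G) M"
definition S' :: "'v set" where "S' = SS G - covered (SS G) M"
definition T1' :: "'v set" where "T1' = unc1 \<union> C1"
definition T2' :: "'v set" where "T2' = unc2 \<union> C2"

definition E' :: "'v set set" where
  "E' = {e \<in> EE G. e \<subseteq> S' \<or>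
           (\<exists>u v. e = {u, v} \<and> (u \<in> T1' \<and> v \<in> S' \<union> T2' \<or> u \<in> T2' \<and> v \<in> S' \<union> T1'))}"

definition contract :: "'v bpm_inst" where
  "contract =
     \<lparr>T1 = T1', T2 = T2', SS = S', EE = E',
      MM1 = direct_sum (matroid_contract (MM1 G) cov1) (free_matroid C1),
      MM2 = direct_sum (matroid_contract (MM2 G) cov2) (free_matroid C2)\<rparr>"

end


section \<open>The matrix \<open>Z(M)\<close>\<close>

text \<open>Rational functions over \<open>'f\<close> in indeterminates indexed by \<open>'x\<close>; the library needs \<open>'x\<close> to be
  linearly ordered for the polynomial ring to be an instance of \<^class>\<open>idom\<close>.\<close>

type_synonym ('x, 'f) ratfun = "(('x \<Rightarrow>\<^sub>0 nat) \<Rightarrow>\<^sub>0 'f) fract"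

definition const :: "'f::field \<Rightarrow> ('x::linorder, 'f) ratfun" where
  "const c = Fraction_Field.Fract (Poly_Mapping.single 0 c) 1"

definition indet :: "'x::linorder \<Rightarrow> ('x, 'f::field) ratfun" where
  "indet n = Fraction_Field.Fract (Poly_Mapping.single (Poly_Mapping.single n 1) 1) 1"

text \<open>\<open>x e\<close> is the name of the indeterminate of the edge \<open>e\<close>.\<close>

definition is_X_matrix ::
    "'v bpm_inst \<Rightarrow> ('v set \<Rightarrow> 'x::linorder) \<Rightarrow> ('v \<Rightarrow> 'v \<Rightarrow> ('x, 'f::field) ratfun) \<Rightarrow> bool" where
  "is_X_matrix G x X \<longleftrightarrow>
     (\<forall>a \<in> T1 G \<union> SS G. \<forall>b \<in> T2 G \<union> SS G.
        if {a, b} \<in> EE G then X a b = indet (x {a, b}) \<or> X a b = - indet (x {a, b})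
        else X a b = 0) \<and>
     (\<forall>a \<in> SS G. \<forall>b \<in> SS G. X b a = - X a b)"

text \<open>Row and column indices of \<open>Z(M)\<close>, tagged with the block they belong to.\<close>

datatype 'v zindex = Blk1 nat | Blk2 'v | Blk3 'v | Blk4 'v | Blk5 'v

definition Z_rows :: "'v bpm_inst \<Rightarrow> nat \<Rightarrow> 'v set set \<Rightarrow> 'v zindex set" where
  "Z_rows G r M =
     Blk1 ` {..<r} \<union> Blk2 ` cov2 G M \<union> Blk3 ` unc2 G M \<union> Blk4 ` unc1 G M \<union>
     Blk5 ` (C1 G M \<union> S' G M)"

definition Z_cols :: "'v bpm_inst \<Rightarrow> nat \<Rightarrow> 'v set set \<Rightarrow> 'v zindex set" where
  "Z_cols G r M =
     Blk1 ` {..<r} \<union> Blk2 ` cov1 G M \<union> Blk3 ` unc1 G M \<union> Blk4 ` unc2 G M \<union>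
     Blk5 ` (C2 G M \<union> S' G M)"

text \<open>\<open>d v\<close> is the name of the indeterminate in the diagonal entry of \<open>D\<^sub>1\<close> or \<open>D\<^sub>2\<close> indexed by \<open>v\<close>.\<close>

definition diag_entry :: "('v \<Rightarrow> 'x::linorder) \<Rightarrow> 'v \<Rightarrow> 'v \<Rightarrow> ('x, 'f::field) ratfun" where
  "diag_entry d u v = (if u = v then indet (d v) else 0)"

fun Z_entry ::
    "(nat \<Rightarrow> 'v \<Rightarrow> 'f::field) \<Rightarrow> ('v \<Rightarrow> nat \<Rightarrow> 'f) \<Rightarrow> ('v \<Rightarrow> 'x::linorder) \<Rightarrow>
     ('v \<Rightarrow> 'v \<Rightarrow> ('x, 'f) ratfun) \<Rightarrow> 'v zindex \<Rightarrow> 'v zindex \<Rightarrow> ('x, 'f) ratfun" where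
  "Z_entry Q1 Q2 d X (Blk1 i) (Blk2 v) = const (Q1 i v)"
| "Z_entry Q1 Q2 d X (Blk1 i) (Blk3 v) = const (Q1 i v)"
| "Z_entry Q1 Q2 d X (Blk2 u) (Blk1 j) = const (Q2 u j)"
| "Z_entry Q1 Q2 d X (Blk3 u) (Blk1 j) = const (Q2 u j)"
| "Z_entry Q1 Q2 d X (Blk3 u) (Blk4 v) = diag_entry d u v"
| "Z_entry Q1 Q2 d X (Blk4 u) (Blk3 v) = diag_entry d u v"
| "Z_entry Q1 Q2 d X (Blk4 u) (Blk4 v) = X u v"
| "Z_entry Q1 Q2 d X (Blk4 u) (Blk5 v) = X u v"
| "Z_entry Q1 Q2 d X (Blk5 u) (Blk4 v) = X u v"
| "Z_entry Q1 Q2 d X (Blk5 u) (Blk5 v) = X u v"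
| "Z_entry Q1 Q2 d X _ _ = 0"

text \<open>A matrix with rows indexed by a finite set \<open>R\<close> and columns indexed by a finite set \<open>C\<close> is
  non-singular iff it is invertible, as a library matrix, after enumerating \<open>R\<close> and \<open>C\<close>; the
  enumerations are immaterial. In particular a non-singular matrix is square.\<close>

definition nonsingular :: "'i set \<Rightarrow> 'j set \<Rightarrow> ('i \<Rightarrow> 'j \<Rightarrow> 'k::field) \<Rightarrow> bool" where
  "nonsingular R C A \<longleftrightarrow>
     (\<exists>rs cs. distinct rs \<and> set rs = R \<and> distinct cs \<and> set cs = C \<and>
        invertible_mat (mat (length rs) (length cs) (\<lambda>(i, j). A (rs ! i) (cs ! j))))"

end

theory Submission
  imports Defs "Jordan_Normal_Form.Determinant"
begin

text \<open>
  If \<open>Z(M)\<close> is nonsingular, then it stays so after clearing the diagonal of \<open>D\<^sub>1\<close> and \<open>D\<^sub>2\<close> and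
  deleting some of their rows and columns, because a determinant is affine in each entry. What remains
  is block triangular: the blocks of \<open>Q\<^sub>1\<close> and \<open>Q\<^sub>2\<close> yield bases, and a nonsingular square block of
  \<open>X\<close> with rows \<open>A \<union> S\<close> and columns \<open>B \<union> S\<close> is left. Expanding it along the row of some \<open>a \<in> A\<close>
  starts a path at \<open>a\<close>; if the chosen column \<open>s\<close> belongs to \<open>S\<close>, then \<open>s\<close> remains only as a row and
  takes over the role of \<open>a\<close>. If \<open>A\<close> is empty, expanding along the row of some \<open>s \<in> S\<close>, with chosen
  column \<open>b\<close>, gives a path from \<open>b\<close> to \<open>s\<close> and a matching of the rest; as a nonsingular alternating
  matrix has even size, the path has an even number of vertices and can be replaced by a matching.

  Conversely, set to 1 the indeterminates of the edges of a basic path-matching and of the vertices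
  it leaves uncovered, and all others to 0. The specialised matrix has trivial kernel.
\<close>


section \<open>Matrices indexed by finite sets\<close>

text \<open>Two obstacles shape the proof. Rows and columns are indexed by tagged vertices and are
  deleted again and again, so signs of permutations would be a constant burden. Nonsingularity is
  therefore handled as equality of cardinalities plus a trivial kernel, and determinants serve
  mainly for transposition and for specialisation. The second obstacle is that the indeterminate of
  an edge inside \<open>S\<close> occurs in two entries of \<open>X\<close>, so terms of the
  determinant may cancel. From matrix to matching no term is ever inspected: only the support of
  \<open>X\<close> and its alternation on \<open>S\<close> matter, and the danger that the support
  yields odd cycles is met by parity. From matching to matrix a nonzero term would prove nothing;
  after the specialisation, however, the support is a disjoint union of paths and single edges,
  along which elimination is forced. Moreover, \<open>M\<close> is not assumed to be a
  path-matching. That \<open>C1\<close> and \<open>C2\<close> are disjoint must come from path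
  components: the end of such a path in \<open>S\<close> determines its other end.\<close>

definition trivial_kernel :: "'i set \<Rightarrow> 'j set \<Rightarrow> ('i \<Rightarrow> 'j \<Rightarrow> 'k::field) \<Rightarrow> bool" where
  "trivial_kernel R C A \<longleftrightarrow>
     (\<forall>v. (\<forall>i\<in>R. (\<Sum>j\<in>C. A i j * v j) = 0) \<longrightarrow> (\<forall>j\<in>C. v j = 0))"

lemma trivial_kernelI:
  assumes "\<And>v. (\<And>i. i \<in> R \<Longrightarrow> (\<Sum>j\<in>C. A i j * v j) = 0) \<Longrightarrow> \<forall>j\<in>C. v j = 0"
  shows "trivial_kernel R C A"
  using assms unfolding trivial_kernel_def by blast

lemma trivial_kernelD:
  assumes "trivial_kernel R C A" and "\<And>i. i \<in> R \<Longrightarrow> (\<Sum>j\<in>C. A i j * v j) = 0" and "j \<in> C"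
  shows "v j = 0"
  using assms unfolding trivial_kernel_def by blast

lemma sum_set_nth:
  assumes "distinct cs"
  shows "(\<Sum>j\<in>set cs. f j) = (\<Sum>k<length cs. f (cs ! k))"
  using sum.reindex_bij_betw[OF bij_betw_nth[OF assms refl refl], of f] by (simp add: lessThan_def)

definition enum_mat :: "'i list \<Rightarrow> 'j list \<Rightarrow> ('i \<Rightarrow> 'j \<Rightarrow> 'k) \<Rightarrow> 'k mat" where
  "enum_mat rs cs A = mat (length rs) (length cs) (\<lambda>(i, j). A (rs ! i) (cs ! j))"

lemma enum_mat_carrier [simp]: "enum_mat rs cs A \<in> carrier_mat (length rs) (length cs)"
  by (simp add: enum_mat_def)

lemma enum_mat_mult_vec:
  assumes "distinct cs" and "i < length rs" and "dim_vec w = length cs"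
    and "\<And>k. k < length cs \<Longrightarrow> w $ k = v (cs ! k)"
  shows "(enum_mat rs cs A *\<^sub>v w) $ i = (\<Sum>j\<in>set cs. A (rs ! i) j * v j)"
  using assms by (simp add: enum_mat_def scalar_prod_def sum_set_nth atLeast0LessThan)

text \<open>The right-hand side no longer mentions the enumerations, which is what makes them
  immaterial later.\<close>

lemma det_enum_mat_nonzero_iff:
  fixes A :: "'a \<Rightarrow> 'b \<Rightarrow> 'c::field"
  assumes "distinct rs" and cs: "distinct cs" and len: "length rs = length cs"
  shows "det (enum_mat rs cs A) \<noteq> 0 \<longleftrightarrow> trivial_kernel (set rs) (set cs) A"
proof -
  have car: "enum_mat rs cs A \<in> carrier_mat (length cs) (length cs)"
    using len enum_mat_carrier by metis
  note iff = det_0_iff_vec_prod_zero_field[OF car]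
  show ?thesis
  proof
    assume nz: "det (enum_mat rs cs A) \<noteq> 0"
    show "trivial_kernel (set rs) (set cs) A"
    proof (rule trivial_kernelI)
      fix v assume v: "\<And>i. i \<in> set rs \<Longrightarrow> (\<Sum>j\<in>set cs. A i j * v j) = 0"
      define w where "w = vec (length cs) (\<lambda>k. v (cs ! k))"
      have "enum_mat rs cs A *\<^sub>v w = 0\<^sub>v (length cs)"
      proof (rule eq_vecI)
        fix i assume "i < dim_vec (0\<^sub>v (length cs) :: 'c vec)"
        then have i: "i < length rs" using len by simp
        have "(enum_mat rs cs A *\<^sub>v w) $ i = (\<Sum>j\<in>set cs. A (rs ! i) j * v j)"
          by (rule enum_mat_mult_vec[OF cs i]) (simp_all add: w_def)
        then show "(enum_mat rs cs A *\<^sub>v w) $ i = 0\<^sub>v (length cs) $ i"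
          using v[of "rs ! i"] i len by simp
      qed (use len in \<open>simp add: enum_mat_def\<close>)
      moreover have "w \<in> carrier_vec (length cs)" by (simp add: w_def)
      ultimately have w0: "w = 0\<^sub>v (length cs)" using nz unfolding iff by blast
      have "v (cs ! k) = 0" if "k < length cs" for k
        using that arg_cong[OF w0, of "\<lambda>u. u $ k"] by (simp add: w_def)
      then show "\<forall>j\<in>set cs. v j = 0" by (metis in_set_conv_nth)
    qed
  next
    assume tk: "trivial_kernel (set rs) (set cs) A"
    show "det (enum_mat rs cs A) \<noteq> 0"
    proof
      assume "det (enum_mat rs cs A) = 0"
      then obtain w where w: "w \<in> carrier_vec (length cs)" "w \<noteq> 0\<^sub>v (length cs)"
        "enum_mat rs cs A *\<^sub>v w = 0\<^sub>v (length cs)" unfolding iff by blast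
      \<comment> \<open>The inverse of the enumeration \<open>cs\<close> turns the position-indexed
        vector into a family indexed by the column set.\<close>
      define v where "v j = w $ (THE k. k < length cs \<and> cs ! k = j)" for j
      have v: "v (cs ! k) = w $ k" if "k < length cs" for k
        unfolding v_def using cs that
        by (intro arg_cong[where f = "($) w"] the_equality) (auto simp: nth_eq_iff_index_eq)
      have Av: "(\<Sum>j\<in>set cs. A i j * v j) = 0" if i: "i \<in> set rs" for i
      proof -
        obtain l where l: "l < length rs" "rs ! l = i" using i by (metis in_set_conv_nth)
        have "(enum_mat rs cs A *\<^sub>v w) $ l = (\<Sum>j\<in>set cs. A (rs ! l) j * v j)"
          by (rule enum_mat_mult_vec) (use cs l w v in auto)
        then show ?thesis using w l len by simp
      qed
      have "v j = 0" if "j \<in> set cs" for j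
        using trivial_kernelD[OF tk Av that] .
      then have "w = 0\<^sub>v (length cs)"
        using w(1) v[symmetric] by (intro eq_vecI) auto
      with w show False by simp
    qed
  qed
qed

lemma invertible_mat_iff_det:
  fixes A :: "'k::field mat"
  assumes A: "A \<in> carrier_mat n n"
  shows "invertible_mat A \<longleftrightarrow> det A \<noteq> 0"
proof
  assume "invertible_mat A"
  then obtain B where B: "A * B = 1\<^sub>m n" "B * A = 1\<^sub>m (dim_row B)"
    using A unfolding invertible_mat_def inverts_mat_def by auto
  then have "B \<in> carrier_mat n n" using A
    by (metis carrier_matD(2) carrier_matI index_mult_mat(2,3) index_one_mat(2,3))
  then have "det A * det B = 1" using B det_mult[OF A] by (metis det_one)
  then show "det A \<noteq> 0" by auto
next
  assume "det A \<noteq> 0"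
  then have "A \<in> Units (ring_mat TYPE('k) n ())" by (rule det_non_zero_imp_unit[OF A])
  then show "invertible_mat A" using A
    unfolding Units_def invertible_mat_def inverts_mat_def ring_mat_def by auto
qed

text \<open>\<open>nonsingular\<close> only promises some pair of enumerations. Any other pair works
  as well, since both determinants are controlled by the same kernel.\<close>

lemma nonsingular_iff_det:
  assumes "distinct rs" "distinct cs" "length rs = length cs"
  shows "nonsingular (set rs) (set cs) A \<longleftrightarrow> det (enum_mat rs cs A) \<noteq> 0"
proof
  assume "nonsingular (set rs) (set cs) A"
  then obtain rs' cs' where *: "distinct rs'" "set rs' = set rs" "distinct cs'" "set cs' = set cs"
    "invertible_mat (enum_mat rs' cs' A)" unfolding nonsingular_def enum_mat_def by blast
  then have len: "length rs' = length cs'"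
    using assms by (metis distinct_card)
  have car: "enum_mat rs' cs' A \<in> carrier_mat (length cs') (length cs')"
    using len enum_mat_carrier by metis
  show "det (enum_mat rs cs A) \<noteq> 0"
    using invertible_mat_iff_det[OF car] det_enum_mat_nonzero_iff[of rs' cs' A]
      det_enum_mat_nonzero_iff[of rs cs A] * assms len by auto
next
  assume nz: "det (enum_mat rs cs A) \<noteq> 0"
  have car: "enum_mat rs cs A \<in> carrier_mat (length cs) (length cs)"
    using assms enum_mat_carrier by metis
  show "nonsingular (set rs) (set cs) A"
    unfolding nonsingular_def enum_mat_def[symmetric]
    using invertible_mat_iff_det[OF car] nz assms by blast
qed

lemma nonsingular_imp_finite_card:
  assumes "nonsingular R C A"
  shows "finite R" "finite C" "card R = card C"
proof -
  obtain rs cs where *: "distinct rs" "set rs = R" "distinct cs" "set cs = C"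
    "invertible_mat (enum_mat rs cs A)" using assms unfolding nonsingular_def enum_mat_def by blast
  then show "finite R" "finite C" by auto
  from *(5) have "length rs = length cs" by (simp add: invertible_mat_def enum_mat_def)
  then show "card R = card C" using * distinct_card by metis
qed

lemma nonsingular_iff_trivial_kernel:
  assumes "finite R" and "finite C"
  shows "nonsingular R C A \<longleftrightarrow> card R = card C \<and> trivial_kernel R C A"
proof (cases "card R = card C")
  case True
  obtain rs cs where *: "distinct rs" "set rs = R" "distinct cs" "set cs = C"
    using assms finite_distinct_list by metis
  then have "length rs = length cs" using True by (metis distinct_card)
  then show ?thesis using True * nonsingular_iff_det det_enum_mat_nonzero_iff by metis
qed (use nonsingular_imp_finite_card in blast)

lemma nonsingular_trivial_kernel: "nonsingular R C A \<Longrightarrow> trivial_kernel R C A"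
  using nonsingular_imp_finite_card nonsingular_iff_trivial_kernel by metis

text \<open>A kernel sees linear dependence of columns only; this is the passage to rows.\<close>

lemma nonsingular_transpose:
  assumes "nonsingular R C A"
  shows "nonsingular C R (\<lambda>j i. A i j)"
proof -
  obtain rs cs where *: "distinct rs" "set rs = R" "distinct cs" "set cs = C"
    using assms nonsingular_imp_finite_card finite_distinct_list by metis
  then have len: "length rs = length cs"
    using assms nonsingular_imp_finite_card by (metis distinct_card)
  have "enum_mat cs rs (\<lambda>j i. A i j) = transpose_mat (enum_mat rs cs A)"
    by (rule eq_matI) (auto simp: enum_mat_def)
  then have "det (enum_mat cs rs (\<lambda>j i. A i j)) = det (enum_mat rs cs A)"
    using det_transpose enum_mat_carrier len by metis
  then show ?thesis using assms nonsingular_iff_det * len by metis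
qed

section \<open>Linear systems, minors and cleared entries\<close>

lemma nonsingular_solve:
  assumes "nonsingular R C A"
  obtains v where "\<And>i. i \<in> R \<Longrightarrow> (\<Sum>j\<in>C. A i j * v j) = b i"
proof -
  obtain rs cs where *: "distinct rs" "set rs = R" "distinct cs" "set cs = C"
    "invertible_mat (enum_mat rs cs A)" using assms unfolding nonsingular_def enum_mat_def by blast
  have len: "length rs = length cs"
    using * assms nonsingular_imp_finite_card by (metis distinct_card)
  obtain B where B: "enum_mat rs cs A * B = 1\<^sub>m (length cs)" "B * enum_mat rs cs A = 1\<^sub>m (dim_row B)"
    using *(5) len unfolding invertible_mat_def inverts_mat_def by (auto simp: enum_mat_def)
  then have Bc: "B \<in> carrier_mat (length cs) (length cs)"
    using carrier_matD[OF enum_mat_carrier[of rs cs A]]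
    by (metis carrier_matI index_mult_mat(2,3) index_one_mat(2,3))
  define bv where "bv = vec (length cs) (\<lambda>k. b (rs ! k))"
  define w where "w = B *\<^sub>v bv"
  have w: "dim_vec w = length cs" using Bc by (simp add: w_def)
  have Aw: "enum_mat rs cs A *\<^sub>v w = bv"
    unfolding w_def using B Bc len enum_mat_carrier[of rs cs A]
    by (subst assoc_mult_mat_vec[symmetric, of _ "length cs" "length cs"]) (auto simp: bv_def)
  define v where "v j = w $ (THE k. k < length cs \<and> cs ! k = j)" for j
  have v: "v (cs ! k) = w $ k" if "k < length cs" for k
    unfolding v_def using * that
    by (intro arg_cong[where f = "($) w"] the_equality) (auto simp: nth_eq_iff_index_eq)
  show thesis
  proof
    fix i assume "i \<in> R"
    then obtain l where l: "l < length rs" "rs ! l = i" using * by (metis in_set_conv_nth)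
    have "(enum_mat rs cs A *\<^sub>v w) $ l = (\<Sum>j\<in>set cs. A (rs ! l) j * v j)"
      by (rule enum_mat_mult_vec) (use * l w v in auto)
    then show "(\<Sum>j\<in>C. A i j * v j) = b i" using Aw l len * by (simp add: bv_def)
  qed
qed

text \<open>With too few rows, zero rows can be added to make the matrix square. The kernel stays
  trivial, yet a zero row is a kernel vector of the transpose.\<close>

lemma card_le_of_trivial_kernel:
  fixes A :: "'i \<Rightarrow> 'j \<Rightarrow> 'k::field"
  assumes R: "finite R" and C: "finite C" and tk: "trivial_kernel R C A"
  shows "card C \<le> card R"
proof (rule ccontr)
  assume "\<not> card C \<le> card R"
  then have less: "card R < card C" by simp
  then obtain h where h: "inj_on h R" "h ` R \<subseteq> C"
    using inj_on_iff_card_le[OF R C] by auto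
  then have "h ` R \<noteq> C" using less by (metis card_image less_irrefl)
  with h have h: "inj_on h R" "h ` R \<subset> C" by auto
  define B where "B c j = (if c \<in> h ` R then A (inv_into R h c) j else 0)" for c j
  have "trivial_kernel C C B"
  proof (rule trivial_kernelI)
    fix v assume v: "\<And>i. i \<in> C \<Longrightarrow> (\<Sum>j\<in>C. B i j * v j) = 0"
    have "(\<Sum>j\<in>C. A i j * v j) = 0" if "i \<in> R" for i
      using v[of "h i"] that h by (auto simp: B_def)
    then show "\<forall>j\<in>C. v j = 0" using trivial_kernelD[OF tk] by blast
  qed
  then have "nonsingular C C B" using C nonsingular_iff_trivial_kernel by blast
  then have tk': "trivial_kernel C C (\<lambda>j i. B i j)"
    using nonsingular_transpose nonsingular_trivial_kernel by blast
  obtain c where c: "c \<in> C" "c \<notin> h ` R" using h by blast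
  \<comment> \<open>The unit vector at the zero row \<open>c\<close>, evaluated at \<open>c\<close>
    itself.\<close>
  have "(if c = c then 1 else 0 :: 'k) = 0"
    by (rule trivial_kernelD[OF tk', of "\<lambda>i. if i = c then 1 else 0"])
       (use c C in \<open>auto simp: B_def intro!: sum.neutral\<close>)
  then show False by simp
qed


text \<open>A kernel vector of the block, extended by 0 to the other columns, is a kernel vector of
  the whole matrix, because the columns of the block vanish outside its rows.\<close>

lemma trivial_kernel_block:
  fixes A :: "'i \<Rightarrow> 'j \<Rightarrow> 'k::field"
  assumes tk: "trivial_kernel R C A" and C: "finite C" "C' \<subseteq> C"
    and z: "\<And>i j. i \<in> R - R' \<Longrightarrow> j \<in> C' \<Longrightarrow> A i j = 0"
  shows "trivial_kernel R' C' A"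
proof (rule trivial_kernelI)
  fix v assume v: "\<And>i. i \<in> R' \<Longrightarrow> (\<Sum>j\<in>C'. A i j * v j) = 0"
  define w where "w j = (if j \<in> C' then v j else 0)" for j
  have *: "(\<Sum>j\<in>C. A i j * w j) = (\<Sum>j\<in>C'. A i j * v j)" for i
    using C by (intro sum.mono_neutral_cong_right) (auto simp: w_def)
  have "(\<Sum>j\<in>C. A i j * w j) = 0" if "i \<in> R" for i
    unfolding * using v[of i] z[of i] that by (cases "i \<in> R'") (auto intro: sum.neutral)
  then have "\<forall>j\<in>C. w j = 0" using trivial_kernelD[OF tk] by blast
  then show "\<forall>j\<in>C'. v j = 0" using C(2) by (force simp: w_def)
qed

text \<open>By Cramer's rule, \<open>v b\<close> is up to sign the quotient of the minor by the determinant.\<close>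

lemma nonsingular_minor:
  fixes A :: "'i \<Rightarrow> 'j \<Rightarrow> 'k::field"
  assumes ns: "nonsingular R C A" and a: "a \<in> R" and b: "b \<in> C" and vb: "v b \<noteq> 0"
    and v: "\<And>i. i \<in> R \<Longrightarrow> (\<Sum>j\<in>C. A i j * v j) = (if i = a then 1 else 0)"
  shows "nonsingular (R - {a}) (C - {b}) A"
proof -
  note fin = nonsingular_imp_finite_card[OF ns]
  have "trivial_kernel (R - {a}) (C - {b}) A"
  proof (rule trivial_kernelI)
    fix w assume w: "\<And>i. i \<in> R - {a} \<Longrightarrow> (\<Sum>j\<in>C - {b}. A i j * w j) = 0"
    define u where "u = w(b := 0)"
    define \<beta> where "\<beta> = (\<Sum>j\<in>C. A a j * u j)"
    have u: "(\<Sum>j\<in>C. A i j * u j) = (\<Sum>j\<in>C - {b}. A i j * w j)" for i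
      using fin b by (simp add: sum.remove[of C b] u_def)
    \<comment> \<open>\<open>u\<close> violates only the row of \<open>a\<close>, by the amount
      \<open>\<beta>\<close>; subtracting \<open>\<beta> * v\<close> repairs this. Since
      \<open>u b = 0\<close> and \<open>v b \<noteq> 0\<close>, the resulting kernel vector being
      zero forces \<open>\<beta> = 0\<close>.\<close>
    have "(\<Sum>j\<in>C. A i j * (u j - \<beta> * v j)) = 0" if i: "i \<in> R" for i
    proof -
      have "(\<Sum>j\<in>C. A i j * (u j - \<beta> * v j))
          = (\<Sum>j\<in>C. A i j * u j) - \<beta> * (\<Sum>j\<in>C. A i j * v j)"
        by (simp add: sum_subtractf sum_distrib_left algebra_simps)
      also have "\<dots> = 0"
        using w[of i] v[OF i] i by (cases "i = a") (simp_all add: u \<beta>_def)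
      finally show ?thesis .
    qed
    then have 0: "u j - \<beta> * v j = 0" if "j \<in> C" for j
      using trivial_kernelD[OF nonsingular_trivial_kernel[OF ns], of "\<lambda>j. u j - \<beta> * v j"] that
      by blast
    have "\<beta> = 0" using 0[OF b] vb by (simp add: u_def)
    then have "u j = 0" if "j \<in> C" for j using 0[OF that] by simp
    then show "\<forall>j\<in>C - {b}. w j = 0" by (metis DiffE fun_upd_other singletonI u_def)
  qed
  then show ?thesis using fin a b by (simp add: nonsingular_iff_trivial_kernel)
qed

text \<open>The solution \<open>v\<close> for the unit vector at \<open>a\<close> is a column of the
  inverse. Its product with row \<open>a\<close> is 1, so some summand is nonzero, and the factor
  \<open>v b\<close> of that summand certifies the minor.\<close>

lemma nonsingular_expand_row:
  fixes A :: "'i \<Rightarrow> 'j \<Rightarrow> 'k::field"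
  assumes ns: "nonsingular R C A" and a: "a \<in> R"
  obtains b where "b \<in> C" "A a b \<noteq> 0" "nonsingular (R - {a}) (C - {b}) A"
proof -
  obtain v where v: "\<And>i. i \<in> R \<Longrightarrow> (\<Sum>j\<in>C. A i j * v j) = (if i = a then 1 else 0)"
    using nonsingular_solve[OF ns, of "\<lambda>i. if i = a then 1 else 0"] by blast
  have "(\<Sum>j\<in>C. A a j * v j) \<noteq> 0" using v[OF a] by simp
  then obtain b where "b \<in> C" "A a b * v b \<noteq> 0"
    by (rule sum.not_neutral_contains_not_neutral)
  then show thesis using that nonsingular_minor[OF ns a, of b v] v by auto
qed

text \<open>If clearing the entry makes the matrix singular, a kernel vector of the cleared matrix
  is sent by \<open>A\<close> to a multiple of the unit vector at \<open>a\<close>. The multiple is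
  nonzero since \<open>A\<close> is nonsingular, and after scaling the vector certifies the
  minor.\<close>

lemma nonsingular_clear_entry:
  fixes A :: "'i \<Rightarrow> 'j \<Rightarrow> 'k::field"
  assumes ns: "nonsingular R C A" and a: "a \<in> R" and b: "b \<in> C"
  shows "nonsingular (R - {a}) (C - {b}) A \<or>
    nonsingular R C (\<lambda>i j. if i = a \<and> j = b then 0 else A i j)" (is "_ \<or> nonsingular R C ?A0")
proof (rule disjCI)
  note fin = nonsingular_imp_finite_card[OF ns]
  assume "\<not> nonsingular R C ?A0"
  then obtain v k where v: "\<And>i. i \<in> R \<Longrightarrow> (\<Sum>j\<in>C. ?A0 i j * v j) = 0" and k: "k \<in> C" "v k \<noteq> 0"
    using fin unfolding nonsingular_iff_trivial_kernel[OF fin(1,2)] trivial_kernel_def by blast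
  have Av: "(\<Sum>j\<in>C. A i j * v j) = (if i = a then A a b * v b else 0)" if "i \<in> R" for i
    using v[OF that] fin b by (simp add: sum.remove[of C b] split: if_splits)
  have nz: "A a b * v b \<noteq> 0"
  proof
    assume "A a b * v b = 0"
    then have "(\<Sum>j\<in>C. A i j * v j) = 0" if "i \<in> R" for i using Av[OF that] by simp
    then have "v k = 0"
      using trivial_kernelD[OF nonsingular_trivial_kernel[OF ns]] k(1) by blast
    with k show False by simp
  qed
  show "nonsingular (R - {a}) (C - {b}) A"
  proof (rule nonsingular_minor[OF ns a b, of "\<lambda>j. v j / (A a b * v b)"])
    fix i assume "i \<in> R"
    have "(\<Sum>j\<in>C. A i j * (v j / (A a b * v b))) = (\<Sum>j\<in>C. A i j * v j) / (A a b * v b)"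
      by (simp add: sum_divide_distrib)
    then show "(\<Sum>j\<in>C. A i j * (v j / (A a b * v b))) = (if i = a then 1 else 0)"
      using Av[OF \<open>i \<in> R\<close>] nz by simp
  qed (use nz in simp)
qed

section \<open>Alternating matrices\<close>

text \<open>Eliminating an invertible alternating block of size 2 leaves a Schur complement that is
  again alternating and nonsingular. The zero diagonal is a separate assumption because
  skew-symmetry does not imply it in characteristic 2, where the identity matrix of size 1 would be
  a counterexample.\<close>

lemma even_card_of_alternating_nonsingular:
  fixes X :: "'v \<Rightarrow> 'v \<Rightarrow> 'k::field"
  assumes "nonsingular S S X"
    and "\<And>a b. a \<in> S \<Longrightarrow> b \<in> S \<Longrightarrow> X b a = - X a b" and "\<And>a. a \<in> S \<Longrightarrow> X a a = 0"
  shows "even (card S)"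
  using assms
proof (induction "card S" arbitrary: S X rule: less_induct)
  case less
  note ns = less.prems(1) and skew = less.prems(2) and diag = less.prems(3)
  note fin = nonsingular_imp_finite_card(1)[OF ns]
  show ?case
  proof (cases "S = {}")
    case False
    then obtain s where s: "s \<in> S" by blast
    obtain b where b: "b \<in> S" "X s b \<noteq> 0" using nonsingular_expand_row[OF ns s] by blast
    have bs: "b \<noteq> s" using b s diag by auto
    have Xbs: "X b s = - X s b" using skew s b by blast
    define T where "T = S - {s} - {b}"
    \<comment> \<open>the Schur complement of the block indexed by \<open>s\<close> and \<open>b\<close>\<close>
    define Y where "Y u v = X u v + (X u s * X b v - X u b * X s v) / X s b" for u v
    have cardS: "card S = card T + 2"
      using fin s b bs card_Suc_Diff1[of S s] card_Suc_Diff1[of "S - {s}" b] by (simp add: T_def)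
    have sumS: "(\<Sum>j\<in>S. f j) = f s + f b + (\<Sum>j\<in>T. f j)" for f :: "'v \<Rightarrow> 'k"
      using fin s b bs by (simp add: T_def sum.remove[of S s] sum.remove[of "S - {s}" b])
    have "trivial_kernel T T Y"
    proof (rule trivial_kernelI)
      fix v assume v: "\<And>i. i \<in> T \<Longrightarrow> (\<Sum>j\<in>T. Y i j * v j) = 0"
      define p where "p i = (\<Sum>j\<in>T. X i j * v j)" for i
      \<comment> \<open>The two new values are the unique ones that satisfy the rows of
        \<open>b\<close> and \<open>s\<close>; substituting them into the other rows produces
        \<open>Y\<close>.\<close>
      define w where "w = v(s := p b / X s b, b := - p s / X s b)"
      have wT: "w j = v j" if "j \<in> T" for j using that by (auto simp: w_def T_def)
      have wsb: "w s = p b / X s b" "w b = - p s / X s b" using bs by (auto simp: w_def)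
      have sw: "(\<Sum>j\<in>S. X i j * w j) = X i s * (p b / X s b) + X i b * (- p s / X s b) + p i" for i
        by (simp add: sumS wsb wT p_def cong: sum.cong)
      have "(\<Sum>j\<in>S. X i j * w j) = 0" if i: "i \<in> S" for i
      proof -
        consider "i = s" | "i = b" | "i \<in> T" using i by (auto simp: T_def)
        then show ?thesis
        proof cases
          case 3
          have "(\<Sum>j\<in>T. Y i j * v j) = p i + (X i s * p b - X i b * p s) / X s b"
            by (simp add: Y_def p_def algebra_simps sum.distrib sum_subtractf sum_distrib_left
                sum_divide_distrib diff_divide_distrib)
          then show ?thesis using v[OF 3] sw[of i] by (simp add: diff_divide_distrib add.commute)
        qed (use b s diag Xbs in \<open>simp_all add: sw\<close>)
      qed
      then have "\<forall>j\<in>S. w j = 0"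
        using trivial_kernelD[OF nonsingular_trivial_kernel[OF ns], of w] by blast
      then show "\<forall>j\<in>T. v j = 0" using wT by (metis DiffD1 T_def)
    qed
    then have nsT: "nonsingular T T Y"
      using fin nonsingular_iff_trivial_kernel[of T T Y] by (simp add: T_def)
    have "even (card T)"
    proof (rule less.hyps[OF _ nsT])
      fix u v assume uv: "u \<in> T" "v \<in> T"
      then have "u \<in> S" "v \<in> S" by (auto simp: T_def)
      then have "X v u = - X u v" "X v s = - X s v" "X b u = - X u b" "X v b = - X b v"
        "X s u = - X u s" using skew b(1) s by blast+
      then show "Y v u = - Y u v" by (simp add: Y_def algebra_simps add_divide_distrib diff_divide_distrib)
    next
      fix u assume u: "u \<in> T"
      then have "u \<in> S" by (auto simp: T_def)
      then have "X u u = 0" "X b u = - X u b" "X s u = - X u s" using skew diag b(1) s by blast+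
      then show "Y u u = 0" by (simp add: Y_def)
    qed (use cardS in simp)
    then show ?thesis using cardS by simp
  qed simp
qed

section \<open>Path systems in the support of a nonsingular matrix\<close>

lemma path_edges_Nil [simp]: "path_edges [] = {}"
  and path_edges_single [simp]: "path_edges [v] = {}"
  by (auto simp: path_edges_def)

lemma path_edges_Cons:
  assumes "p \<noteq> []"
  shows "path_edges (a # p) = insert {a, hd p} (path_edges p)"
proof -
  have ex: "(\<exists>i. Q i) \<longleftrightarrow> Q 0 \<or> (\<exists>i. Q (Suc i))" for Q :: "nat \<Rightarrow> bool"
    by (metis nat.exhaust)
  show ?thesis
    using assms unfolding path_edges_def set_eq_iff mem_Collect_eq insert_iff
    by (subst ex) (simp add: hd_conv_nth)
qed

lemma path_edges_subset: "e \<in> path_edges p \<Longrightarrow> e \<subseteq> set p"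
  by (auto simp: path_edges_def)

lemma set_path_split:
  assumes "p \<noteq> []" and "hd p \<noteq> last p"
  shows "set p = insert (hd p) (insert (last p) (set (butlast (tl p))))"
proof (cases p)
  case (Cons a q)
  then have "q \<noteq> []" using assms by auto
  then have "set q = insert (last q) (set (butlast q))"
    by (metis append_butlast_last_id insert_is_Un list.simps(15) set_append sup_commute empty_set)
  then show ?thesis using Cons \<open>q \<noteq> []\<close> by simp
qed (use assms in simp)

text \<open>Every other edge is taken, beginning with the first one.\<close>

lemma ex_matching_of_even_path:
  assumes "distinct p" and "even (length p)"
  shows "\<exists>K. K \<subseteq> path_edges p \<and> disjoint K \<and> \<Union>K = set p"
  using assms
proof (induction p rule: induct_list012)
  case (3 a b q)
  then obtain K where K: "K \<subseteq> path_edges q" "disjoint K" "\<Union>K = set q" by auto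
  have "path_edges q \<subseteq> path_edges (b # q)" by (cases "q = []") (auto simp: path_edges_Cons)
  then have "insert {a, b} K \<subseteq> path_edges (a # b # q)" using K by (auto simp: path_edges_Cons)
  moreover have "disjoint (insert {a, b} K)"
    using K "3.prems" by (auto simp: disjoint_def pairwise_insert disjnt_def)
  ultimately show ?case using K by (intro exI[of _ "insert {a, b} K"]) auto
qed auto

text \<open>A path-matching that covers \<open>S\<close> completely and whose path ends are exactly
  \<open>A\<close> and \<open>B\<close>. The vertex classes are parameters because the induction
  moves vertices between them.\<close>

definition path_system ::
    "'v set set \<Rightarrow> 'v set \<Rightarrow> 'v set \<Rightarrow> 'v set \<Rightarrow> 'v list set \<Rightarrow> 'v set set \<Rightarrow> bool" where
  "path_system F A B S P N \<longleftrightarrow>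
     (\<forall>p \<in> P. is_path F p \<and> hd p \<in> A \<and> last p \<in> B \<and> set (butlast (tl p)) \<subseteq> S) \<and>
     disjoint_family_on set P \<and>
     N \<subseteq> F \<and> disjoint N \<and> (\<forall>e \<in> N. e \<subseteq> S - (\<Union>p\<in>P. set p)) \<and>
     A \<subseteq> hd ` P \<and> B \<subseteq> last ` P \<and> S \<subseteq> (\<Union>p\<in>P. set p) \<union> \<Union>N"

lemma path_systemI:
  assumes "\<And>p. p \<in> P \<Longrightarrow> is_path F p" and "\<And>p. p \<in> P \<Longrightarrow> hd p \<in> A"
    and "\<And>p. p \<in> P \<Longrightarrow> last p \<in> B" and "\<And>p. p \<in> P \<Longrightarrow> set (butlast (tl p)) \<subseteq> S"
    and "\<And>p q. p \<in> P \<Longrightarrow> q \<in> P \<Longrightarrow> p \<noteq> q \<Longrightarrow> set p \<inter> set q = {}"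
    and "N \<subseteq> F" and "disjoint N" and "\<And>e. e \<in> N \<Longrightarrow> e \<subseteq> S"
    and "\<And>e p. e \<in> N \<Longrightarrow> p \<in> P \<Longrightarrow> e \<inter> set p = {}"
    and "A \<subseteq> hd ` P" and "B \<subseteq> last ` P" and "S \<subseteq> (\<Union>p\<in>P. set p) \<union> \<Union>N"
  shows "path_system F A B S P N"
proof -
  have "e \<subseteq> S - (\<Union>p\<in>P. set p)" if "e \<in> N" for e
    using assms(8)[OF that] assms(9)[OF that] by blast
  then show ?thesis
    unfolding path_system_def disjoint_family_on_def by (intro conjI ballI impI assms)
qed

context
  fixes F A B S P N
  assumes PN: "path_system F A B S P N"
begin

lemma path_system_path:
  assumes "p \<in> P"
  shows "is_path F p" "hd p \<in> A" "last p \<in> B" "set (butlast (tl p)) \<subseteq> S"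
  using assms PN by (auto simp: path_system_def)

lemma path_system_disjoint: "p \<in> P \<Longrightarrow> q \<in> P \<Longrightarrow> p \<noteq> q \<Longrightarrow> set p \<inter> set q = {}"
  using PN by (simp add: path_system_def disjoint_family_on_def)

lemma path_system_matching:
  shows "N \<subseteq> F" "disjoint N" "\<And>e. e \<in> N \<Longrightarrow> e \<subseteq> S"
    "\<And>e p. e \<in> N \<Longrightarrow> p \<in> P \<Longrightarrow> e \<inter> set p = {}"
  using PN unfolding path_system_def by blast+

lemma path_system_covers: "A \<subseteq> hd ` P" "B \<subseteq> last ` P" "S \<subseteq> (\<Union>p\<in>P. set p) \<union> \<Union>N"
  using PN by (simp_all add: path_system_def)

context
  assumes AB: "A \<inter> B = {}"
begin

lemma path_system_set:
  assumes "p \<in> P"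
  shows "set p = insert (hd p) (insert (last p) (set (butlast (tl p))))"
  using path_system_path[OF assms] AB by (intro set_path_split) (auto simp: is_path_def)

lemma path_system_subset: "p \<in> P \<Longrightarrow> set p \<subseteq> A \<union> B \<union> S"
  using path_system_set[of p] path_system_path[of p] by auto

end

end

text \<open>The induction is on the number of rows, since every expansion deletes one row and one
  column while vertices may move from \<open>S\<close> to \<open>A\<close> or \<open>B\<close>. The
  matrix \<open>X\<close> itself never changes; its entries matter only through their support and
  the alternation on \<open>S\<close>.\<close>

lemma ex_path_system_of_nonsingular:
  fixes X :: "'v \<Rightarrow> 'v \<Rightarrow> 'k::field"
  assumes "nonsingular (A \<union> S) (B \<union> S) X"
    and "A \<inter> B = {}" and "A \<inter> S = {}" and "B \<inter> S = {}"
    and "\<And>a b. a \<in> A \<union> S \<Longrightarrow> b \<in> B \<union> S \<Longrightarrow> X a b \<noteq> 0 \<Longrightarrow> {a, b} \<in> F"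
    and "\<And>a b. a \<in> S \<Longrightarrow> b \<in> S \<Longrightarrow> X b a = - X a b" and "\<And>a. a \<in> S \<Longrightarrow> X a a = 0"
    and F: "\<And>e. e \<in> F \<Longrightarrow> card e = 2"
  shows "\<exists>P N. path_system F A B S P N"
  using assms(1-7)
proof (induction "card (A \<union> S)" arbitrary: A B S rule: less_induct)
  case less
  note ns = less.prems(1) and disj = less.prems(2-4) and supp = less.prems(5)
    and skew = less.prems(6) and diag = less.prems(7)
  note fin = nonsingular_imp_finite_card[OF ns]
  have IH: "\<exists>P N. path_system F A' B' S' P N"
    if "card (A' \<union> S') < card (A \<union> S)" "nonsingular (A' \<union> S') (B' \<union> S') X"
      "A' \<inter> B' = {}" "A' \<inter> S' = {}" "B' \<inter> S' = {}"
      and sub: "A' \<union> S' \<subseteq> A \<union> S" "B' \<union> S' \<subseteq> B \<union> S" "S' \<subseteq> S" for A' B' S'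
  proof (rule less.hyps[OF that(1-5)])
    show "{a, b} \<in> F" if "a \<in> A' \<union> S'" "b \<in> B' \<union> S'" "X a b \<noteq> 0" for a b
      using supp[OF _ _ that(3)] that(1,2) sub by blast
    show "X b a = - X a b" if "a \<in> S'" "b \<in> S'" for a b using skew that sub(3) by blast
    show "X a a = 0" if "a \<in> S'" for a using diag that sub(3) by blast
  qed
  show ?case
  proof (cases "A = {}")
    case False
    then obtain a where a: "a \<in> A" by blast
    obtain b where b: "b \<in> B \<union> S" "X a b \<noteq> 0" and nsab: "nonsingular (A \<union> S - {a}) (B \<union> S - {b}) X"
      using nonsingular_expand_row[OF ns] a by blast
    have ab: "{a, b} \<in> F" using supp a b by blast
    have anb: "a \<noteq> b" using F[OF ab] by auto
    have card: "card (A \<union> S - {a}) < card (A \<union> S)"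
      by (rule card_Diff1_less) (use fin a in auto)
    show ?thesis
    proof (cases "b \<in> B")
      case True
      have rc: "A - {a} \<union> S = A \<union> S - {a}" "B - {b} \<union> S = B \<union> S - {b}"
        using a True disj by auto
      have dj: "(A - {a}) \<inter> (B - {b}) = {}" "(A - {a}) \<inter> S = {}" "(B - {b}) \<inter> S = {}"
        using disj by auto
      have "\<exists>P N. path_system F (A - {a}) (B - {b}) S P N"
        by (rule IH[OF card[folded rc(1)] nsab[folded rc] dj]) auto
      then obtain P N where PN: "path_system F (A - {a}) (B - {b}) S P N" by blast
      note P = path_system_path[OF PN] and disjP = path_system_disjoint[OF PN]
        and N = path_system_matching[OF PN] and cov = path_system_covers[OF PN]
        and sub = path_system_subset[OF PN dj(1)]
      have new: "set p \<inter> {a, b} = {}" if "p \<in> P" for p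
        using sub[OF that] a True disj by blast
      have "path_system F A B S (insert [a, b] P) N"
      proof (rule path_systemI)
        fix p assume "p \<in> insert [a, b] P"
        then consider "p = [a, b]" | "p \<in> P" by blast
        then have "is_path F p \<and> hd p \<in> A \<and> last p \<in> B \<and> set (butlast (tl p)) \<subseteq> S"
          by cases (use a True ab anb P in \<open>auto simp: is_path_def path_edges_Cons\<close>)
        then show "is_path F p" "hd p \<in> A" "last p \<in> B" "set (butlast (tl p)) \<subseteq> S" by blast+
      next
        fix p q assume "p \<in> insert [a, b] P" "q \<in> insert [a, b] P" "p \<noteq> q"
        then show "set p \<inter> set q = {}" using new[of p] new[of q] disjP[of p q] by auto
      next
        fix e p assume e: "e \<in> N" and "p \<in> insert [a, b] P"
        then consider "p = [a, b]" | "p \<in> P" by blast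
        then show "e \<inter> set p = {}"
        proof cases
          case 1
          have "a \<notin> e" "b \<notin> e" using N(3)[OF e] a True disj by blast+
          then show ?thesis using 1 by simp
        qed (use N(4)[OF e] in blast)
      next
        show "A \<subseteq> hd ` insert [a, b] P" "B \<subseteq> last ` insert [a, b] P" using cov(1,2) anb by auto
        show "S \<subseteq> (\<Union>p\<in>insert [a, b] P. set p) \<union> \<Union>N" using cov(3) by auto
      qed (fact N)+
      then show ?thesis by blast
    next
      case False
      then have bS: "b \<in> S" using b by blast
      define A' where "A' = insert b (A - {a})"
      have rc: "A' \<union> (S - {b}) = A \<union> S - {a}" "B \<union> (S - {b}) = B \<union> S - {b}"
        using a bS disj False by (auto simp: A'_def)
      have dj: "A' \<inter> B = {}" "A' \<inter> (S - {b}) = {}" "B \<inter> (S - {b}) = {}"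
        using disj bS by (auto simp: A'_def)
      have "\<exists>P N. path_system F A' B (S - {b}) P N"
        by (rule IH[OF card[folded rc(1)] nsab[folded rc] dj]) (use bS in \<open>auto simp: A'_def\<close>)
      then obtain P N where PN: "path_system F A' B (S - {b}) P N" by blast
      note P = path_system_path[OF PN] and disjP = path_system_disjoint[OF PN]
        and N = path_system_matching[OF PN] and cov = path_system_covers[OF PN]
        and sub = path_system_subset[OF PN dj(1)]
      have "b \<in> hd ` P" using cov(1) by (auto simp: A'_def)
      then obtain p where p: "p \<in> P" "hd p = b" by blast
      have aq: "a \<notin> set q" if "q \<in> P" for q
        using sub[OF that] a disj anb by (auto simp: A'_def)
      \<comment> \<open>The path from \<open>b\<close> ends in \<open>B\<close>, which is disjoint
        from \<open>S\<close>, so it has a second vertex; after \<open>a\<close> is prepended,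
        \<open>b\<close> is an inner vertex, as it should be for an element of
        \<open>S\<close>.\<close>
      have pnil: "p \<noteq> []" "last p \<noteq> b" using P[OF p(1)] bS disj by (auto simp: is_path_def)
      then obtain q where q: "p = b # q" "q \<noteq> []"
        using p(2) by (cases p) (auto split: if_splits)
      \<comment> \<open>Only \<open>p\<close> can start at \<open>b\<close>, because the paths are
        disjoint.\<close>
      have hdA: "hd p' \<in> A" if p': "p' \<in> P - {p}" for p'
      proof -
        have "p' \<noteq> []" using P(1)[of p'] p' by (auto simp: is_path_def)
        then have "hd p' \<in> set p'" by simp
        then have "hd p' \<noteq> b" using disjP[OF p(1), of p'] p' q by auto
        then show ?thesis using P(2)[of p'] p' by (auto simp: A'_def)
      qed
      have "path_system F A B S (insert (a # p) (P - {p})) N"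
      proof (rule path_systemI)
        fix p' assume p': "p' \<in> insert (a # p) (P - {p})"
        show "is_path F p'"
          using p' P(1) aq[OF p(1)] P(1)[OF p(1)] p(2) pnil(1) ab
          by (auto simp: is_path_def path_edges_Cons)
        show "hd p' \<in> A" using p' a hdA by auto
        show "last p' \<in> B" using p' P(3) p(1) pnil(1) by auto
        show "set (butlast (tl p')) \<subseteq> S"
          using p' P(4)[of p'] P(4)[OF p(1)] q bS by auto
      next
        fix p1 p2 assume "p1 \<in> insert (a # p) (P - {p})" "p2 \<in> insert (a # p) (P - {p})" "p1 \<noteq> p2"
        then show "set p1 \<inter> set p2 = {}"
          using disjP[of p1 p2] disjP[OF p(1), of p1] disjP[OF p(1), of p2] aq[of p1] aq[of p2]
          by auto
      next
        fix e p' assume e: "e \<in> N" and "p' \<in> insert (a # p) (P - {p})"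
        then consider "p' = a # p" | "p' \<in> P" by blast
        then show "e \<inter> set p' = {}"
        proof cases
          case 1
          have "a \<notin> e" using N(3)[OF e] a disj by blast
          then show ?thesis using N(4)[OF e p(1)] 1 by simp
        qed (use N(4)[OF e] in blast)
      next
        show "e \<subseteq> S" if "e \<in> N" for e using N(3)[OF that] by blast
        show "A \<subseteq> hd ` insert (a # p) (P - {p})"
        proof
          fix c assume c: "c \<in> A"
          then have "c \<noteq> b" using bS disj by auto
          then show "c \<in> hd ` insert (a # p) (P - {p})"
            using c cov(1) p(2) by (cases "c = a") (auto simp: A'_def)
        qed
        show "B \<subseteq> last ` insert (a # p) (P - {p})"
          using cov(2) p(1) pnil(1) by force
        have "x \<in> (\<Union>p'\<in>insert (a # p) (P - {p}). set p') \<union> \<Union>N" if x: "x \<in> S" for x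
        proof -
          have "x \<in> set p \<or> x \<in> (\<Union>p'\<in>P - {p}. set p') \<or> x \<in> \<Union>N"
          proof (cases "x = b")
            case False
            then have "x \<in> (\<Union>p'\<in>P. set p') \<union> \<Union>N" using x cov(3) by blast
            then show ?thesis by blast
          qed (simp add: q(1))
          then show ?thesis by auto
        qed
        then show "S \<subseteq> (\<Union>p'\<in>insert (a # p) (P - {p}). set p') \<union> \<Union>N" by blast
      qed (fact N)+
      then show ?thesis by blast
    qed
  next
    case True
    \<comment> \<open>With \<open>A\<close> empty the rows are those of \<open>S\<close> alone, so
      squareness leaves no room for columns from \<open>B\<close>.\<close>
    have "card B + card S = card S"
      using fin True disj card_Un_disjoint[of B S] by simp
    then have B: "B = {}" using fin by simp
    show ?thesis
    proof (cases "S = {}")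
      case True
      then show ?thesis using \<open>A = {}\<close> B
        by (intro exI[of _ "{}"]) (auto simp: path_system_def disjoint_family_on_def)
    next
      case False
      then obtain s where s: "s \<in> S" by blast
      have nsS: "nonsingular S S X" using ns True B by simp
      have finS: "finite S" using fin by simp
      obtain b where b: "b \<in> S" "X s b \<noteq> 0" and nsb: "nonsingular (S - {s}) (S - {b}) X"
        using nonsingular_expand_row[OF nsS s] by blast
      have bs: "b \<noteq> s" using diag b s by auto
      have card: "card (S - {s}) < card (A \<union> S)"
        unfolding True using card_Diff1_less[OF finS s] by simp
      define S0 where "S0 = S - {s, b}"
      have rc: "{b} \<union> S0 = S - {s}" "{s} \<union> S0 = S - {b}" using b s bs by (auto simp: S0_def)
      have dj: "{b} \<inter> {s} = {}" "{b} \<inter> S0 = {}" "{s} \<inter> S0 = {}" "S0 \<subseteq> S"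
        using bs by (auto simp: S0_def)
      \<comment> \<open>Without row \<open>s\<close> and column \<open>b\<close>, the vertex
        \<open>b\<close> is left only as a row and \<open>s\<close> only as a column: they play the
        parts of a start and an end vertex.\<close>
      have "\<exists>P N. path_system F {b} {s} S0 P N"
        by (rule IH[OF card[folded rc(1)] nsb[folded rc] dj(1-3)]) (use s b(1) dj(4) in auto)
      then obtain P N where PN: "path_system F {b} {s} S0 P N" by blast
      note P' = path_system_path[OF PN] and disjP = path_system_disjoint[OF PN]
        and N = path_system_matching[OF PN] and cov = path_system_covers[OF PN]
        and sub = path_system_subset[OF PN dj(1)]
      obtain p where p: "p \<in> P" "hd p = b" using cov(1) by auto
      have "p' = p" if p': "p' \<in> P" for p'
      proof -
        have "hd p' = b" "p' \<noteq> []" "p \<noteq> []"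
          using P'(1,2)[OF p'] P'(1)[OF p(1)] by (auto simp: is_path_def)
        then have "b \<in> set p' \<inter> set p" using p(2) by (metis IntI hd_in_set)
        then show ?thesis using disjP[OF p' p(1)] by blast
      qed
      then have P: "P = {p}" using p(1) by blast
      have path: "is_path F p" using P'(1)[OF p(1)] .
      have sb: "{s, b} \<subseteq> set p"
        using path_system_set[OF PN dj(1) p(1)] P'(3)[OF p(1)] p(2) by auto
      have setp: "set p \<subseteq> S" using sub[OF p(1)] b(1) s dj(4) by blast
      have UN: "\<Union>N = S - set p"
      proof
        show "\<Union>N \<subseteq> S - set p" using N(3) N(4)[OF _ p(1)] dj(4) by blast
        show "S - set p \<subseteq> \<Union>N" using cov(3) sb by (auto simp: P S0_def)
      qed
      have "card (\<Union>N) = sum card N"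
      proof (rule card_Union_disjoint)
        show "finite e" if "e \<in> N" for e
          using N(1) F[of e] that by (intro card_ge_0_finite) auto
      qed (use N(2) in simp)
      also have "\<dots> = 2 * card N" using N(1) F by (subst sum.cong[OF refl, of _ _ "\<lambda>_. 2"]) auto
      finally have "even (card (S - set p))" using UN by simp
      moreover have "even (card S)"
        using even_card_of_alternating_nonsingular[OF nsS] skew diag by blast
      moreover have "card S = card (S - set p) + card (set p)"
        using card_Diff_subset[OF finite_set setp] card_mono[OF finS setp] by simp
      ultimately have "even (length p)"
        using path by (simp add: is_path_def distinct_card)
      then obtain K where K: "K \<subseteq> path_edges p" "disjoint K" "\<Union>K = set p"
        using ex_matching_of_even_path path by (metis is_path_def)
      have "path_system F {} {} S {} (N \<union> K)"
      proof (rule path_systemI)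
        show "N \<union> K \<subseteq> F" using N(1) K(1) path by (auto simp: is_path_def)
        show "disjoint (N \<union> K)"
          using N(2) K(2) by (rule disjoint_union) (use UN K(3) in auto)
        show "e \<subseteq> S" if "e \<in> N \<union> K" for e using that UN K(3) setp by blast
        show "S \<subseteq> (\<Union>p\<in>{}. set p) \<union> \<Union>(N \<union> K)" using UN K(3) by simp
      qed auto
      then show ?thesis using True B by blast
    qed
  qed
qed


section \<open>Specialising indeterminates\<close>

text \<open>The value of a polynomial when the indeterminates in \<open>U\<close> are set to 1 and the others to 0.\<close>

definition spec :: "'x set \<Rightarrow> (('x \<Rightarrow>\<^sub>0 nat) \<Rightarrow>\<^sub>0 'f::field) \<Rightarrow> 'f" where
  "spec U p = (\<Sum>m\<in>Poly_Mapping.keys p.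
     if Poly_Mapping.keys m \<subseteq> U then Poly_Mapping.lookup p m else 0)"

lemma spec_superset:
  assumes "finite K" "Poly_Mapping.keys p \<subseteq> K"
  shows "spec U p = (\<Sum>m\<in>K. if Poly_Mapping.keys m \<subseteq> U then Poly_Mapping.lookup p m else 0)"
  unfolding spec_def using assms
  by (intro sum.mono_neutral_left) (auto simp: in_keys_iff)

lemma spec_add: "spec U (p + q) = spec U p + spec U q"
proof -
  let ?K = "Poly_Mapping.keys p \<union> Poly_Mapping.keys q"
  have "spec U (p + q) =
      (\<Sum>m\<in>?K. if Poly_Mapping.keys m \<subseteq> U then Poly_Mapping.lookup (p + q) m else 0)"
    by (rule spec_superset) (auto simp: keys_add)
  also have "\<dots> = (\<Sum>m\<in>?K. if Poly_Mapping.keys m \<subseteq> U then Poly_Mapping.lookup p m else 0) +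
      (\<Sum>m\<in>?K. if Poly_Mapping.keys m \<subseteq> U then Poly_Mapping.lookup q m else 0)"
    unfolding sum.distrib[symmetric] by (rule sum.cong) (auto simp: lookup_add)
  also have "\<dots> = spec U p + spec U q"
    by (simp add: spec_superset[of ?K p] spec_superset[of ?K q])
  finally show ?thesis .
qed

lemma spec_single: "spec U (Poly_Mapping.single m c) = (if Poly_Mapping.keys m \<subseteq> U then c else 0)"
  by (subst spec_superset[of "{m}"]) auto

lemma spec_zero: "spec U 0 = 0"
  by (simp add: spec_def)

lemma spec_sum: "spec U (sum f A) = (\<Sum>a\<in>A. spec U (f a))"
  by (induction A rule: infinite_finite_induct) (simp_all add: spec_zero spec_add)

lemma poly_mapping_sum_single:
  "p = (\<Sum>m\<in>Poly_Mapping.keys p. Poly_Mapping.single m (Poly_Mapping.lookup p m))"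
proof (rule poly_mapping_eqI)
  fix k
  have "Poly_Mapping.lookup (\<Sum>m\<in>Poly_Mapping.keys p. Poly_Mapping.single m (Poly_Mapping.lookup p m)) k
     = (\<Sum>m\<in>Poly_Mapping.keys p. if m = k then Poly_Mapping.lookup p k else 0)"
    unfolding lookup_sum by (rule sum.cong) (auto simp: lookup_single when_def)
  also have "\<dots> = Poly_Mapping.lookup p k" by (simp add: in_keys_iff)
  finally show "Poly_Mapping.lookup p k = Poly_Mapping.lookup
      (\<Sum>m\<in>Poly_Mapping.keys p. Poly_Mapping.single m (Poly_Mapping.lookup p m)) k" by simp
qed

lemma spec_mult:
  fixes p q :: "('x \<Rightarrow>\<^sub>0 nat) \<Rightarrow>\<^sub>0 'f::field"
  shows "spec U (p * q) = spec U p * spec U q"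
proof -
  let ?l = Poly_Mapping.lookup and ?s = Poly_Mapping.single and ?k = Poly_Mapping.keys
  \<comment> \<open>Exponents are natural numbers, so no indeterminate cancels in a product of
    monomials. This is why evaluation at 0 and 1 is multiplicative.\<close>
  have keys_plus: "?k (m + n) = ?k m \<union> ?k n" for m n :: "'x \<Rightarrow>\<^sub>0 nat"
    by (auto simp: in_keys_iff lookup_add)
  have "p * q = (\<Sum>m\<in>?k p. ?s m (?l p m)) * (\<Sum>n\<in>?k q. ?s n (?l q n))"
    using poly_mapping_sum_single by metis
  also have "\<dots> = (\<Sum>m\<in>?k p. \<Sum>n\<in>?k q. ?s (m + n) (?l p m * ?l q n))"
    by (simp add: sum_product mult_single)
  finally have "spec U (p * q) = (\<Sum>m\<in>?k p. \<Sum>n\<in>?k q.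
      (if ?k m \<subseteq> U then ?l p m else 0) * (if ?k n \<subseteq> U then ?l q n else 0))"
    by (auto simp: spec_sum spec_single keys_plus intro!: sum.cong)
  then show ?thesis by (simp add: spec_def sum_product)
qed

lemma comm_ring_hom_spec: "comm_ring_hom (spec U)"
proof
  show "spec U 1 = 1" using spec_single[of U 0 1] by simp
qed (simp_all add: spec_zero spec_add spec_mult)

lemma enum_mat_map: "enum_mat rs cs (\<lambda>i j. h (A i j)) = map_mat h (enum_mat rs cs A)"
  by (rule eq_matI) (auto simp: enum_mat_def)

text \<open>Specialisation is a homomorphism on polynomials but not on fractions, so the determinant
  is formed in the polynomial ring. A nonzero value shows that it is a nonzero polynomial, and the
  embedding into the fraction field preserves this.\<close>

lemma nonsingular_if_spec:
  fixes A :: "'i \<Rightarrow> 'j \<Rightarrow> ('x::linorder \<Rightarrow>\<^sub>0 nat) \<Rightarrow>\<^sub>0 'f::field"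
  assumes "nonsingular R C (\<lambda>i j. spec U (A i j))"
  shows "nonsingular R C (\<lambda>i j. to_fract (A i j))"
proof -
  interpret spec: comm_ring_hom "spec U :: (('x \<Rightarrow>\<^sub>0 nat) \<Rightarrow>\<^sub>0 'f) \<Rightarrow> 'f" by (rule comm_ring_hom_spec)
  interpret frac: comm_ring_hom "to_fract :: (('x \<Rightarrow>\<^sub>0 nat) \<Rightarrow>\<^sub>0 'f) \<Rightarrow> _"
    by unfold_locales simp_all
  obtain rs cs where *: "distinct rs" "set rs = R" "distinct cs" "set cs = C"
    using assms nonsingular_imp_finite_card finite_distinct_list by metis
  then have len: "length rs = length cs"
    using assms nonsingular_imp_finite_card(3) by (metis distinct_card)
  have "det (enum_mat rs cs (\<lambda>i j. spec U (A i j))) \<noteq> 0"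
    using assms nonsingular_iff_det[OF *(1,3) len] * by metis
  then have "spec U (det (enum_mat rs cs A)) \<noteq> 0"
    unfolding enum_mat_map[where h = "spec U"] by simp
  then have "det (enum_mat rs cs A) \<noteq> 0" by auto
  then have "det (enum_mat rs cs (\<lambda>i j. to_fract (A i j))) \<noteq> 0"
    unfolding enum_mat_map[where h = to_fract] frac.hom_det by simp
  then show ?thesis using nonsingular_iff_det[OF *(1,3) len] * by metis
qed

lemma const_eq: "const c = to_fract (Poly_Mapping.single 0 c)"
  by (simp add: const_def to_fract_def)

lemma indet_eq: "indet n = to_fract (Poly_Mapping.single (Poly_Mapping.single n 1) 1)"
  by (simp add: indet_def to_fract_def)

lemma const_0 [simp]: "const 0 = 0"
  by (simp add: const_eq)

lemma const_eq_0_iff [simp]: "const c = 0 \<longleftrightarrow> c = 0"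
proof -
  have "Poly_Mapping.single 0 c = 0 \<longleftrightarrow> c = 0"
    by (metis lookup_single_eq lookup_zero single_zero)
  then show ?thesis by (simp add: const_eq)
qed

lemma const_add: "const (a + b) = const a + const b"
  by (simp add: const_eq single_add)

lemma const_mult: "const (a * b) = const a * const b"
  by (simp add: const_eq mult_single flip: to_fract_mult)

lemma const_sum: "const (sum f A) = (\<Sum>a\<in>A. const (f a))"
  by (induction A rule: infinite_finite_induct) (simp_all add: const_add)


section \<open>Bases of matroids\<close>

lemma matroid_indep_subset_ground: "is_matroid A \<Longrightarrow> I \<in> indep A \<Longrightarrow> I \<subseteq> ground A"
  by (simp add: is_matroid_def)

lemma matroid_exchange:
  assumes "is_matroid A" "I \<in> indep A" "J \<in> indep A" "card I < card J"
  obtains e where "e \<in> J - I" "insert e I \<in> indep A"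
  using assms unfolding is_matroid_def by meson

lemma finite_card_indep:
  assumes "is_matroid A"
  shows "finite (card ` indep A)"
proof -
  have "indep A \<subseteq> Pow (ground A)" "finite (ground A)" using assms by (auto simp: is_matroid_def)
  then show ?thesis by (meson finite_Pow_iff finite_imageI finite_subset)
qed

lemma card_indep_le_rank:
  assumes "is_matroid A" and "I \<in> indep A"
  shows "card I \<le> matroid_rank A"
  unfolding matroid_rank_def using finite_card_indep[OF assms(1)] assms(2) by simp

text \<open>By exchange, a maximal independent set has maximum size.\<close>

lemma matroid_basis_iff:
  assumes A: "is_matroid A"
  shows "matroid_basis A B \<longleftrightarrow> B \<in> indep A \<and> card B = matroid_rank A"
proof
  assume "matroid_basis A B"
  then have B: "B \<in> indep A" "\<And>J. J \<in> indep A \<Longrightarrow> B \<subseteq> J \<Longrightarrow> J \<subseteq> ground A \<Longrightarrow> J = B"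
    by (auto simp: matroid_basis_def basis_in_def)
  have "matroid_rank A \<in> card ` indep A"
    unfolding matroid_rank_def
    by (rule Max_in[OF finite_card_indep[OF A]]) (use B(1) in blast)
  then obtain J where J: "J \<in> indep A" "card J = matroid_rank A" by auto
  have "\<not> card B < card J"
  proof
    assume "card B < card J"
    then obtain e where e: "e \<in> J - B" "insert e B \<in> indep A"
      by (rule matroid_exchange[OF A B(1) J(1)])
    have "insert e B = B"
      using B(2)[OF e(2)] matroid_indep_subset_ground[OF A e(2)] by blast
    then show False using e(1) by blast
  qed
  then show "B \<in> indep A \<and> card B = matroid_rank A"
    using B(1) J(2) card_indep_le_rank[OF A B(1)] by simp
next
  assume B: "B \<in> indep A \<and> card B = matroid_rank A"
  have gr: "J \<subseteq> ground A" "finite J" if "J \<in> indep A" for J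
    using A matroid_indep_subset_ground[OF A that] by (auto simp: is_matroid_def intro: finite_subset)
  have "J = B" if "J \<in> indep A" "B \<subseteq> J" for J
    using card_seteq[OF gr(2)[OF that(1)] that(2)] card_indep_le_rank[OF A that(1)] B by simp
  then show "matroid_basis A B" using B gr by (auto simp: matroid_basis_def basis_in_def)
qed

lemma basis_in_indep:
  assumes "is_matroid A" and "W \<in> indep A"
  shows "basis_in A W B \<longleftrightarrow> B = W"
  using assms unfolding basis_in_def by blast

text \<open>An independent \<open>W\<close> is its own only basis, so independence in the
  contraction means independence together with \<open>W\<close>; the free summand lies entirely in
  every basis. Disjointness of \<open>C\<close> from the ground set allows the two parts of a basis
  to be told apart.\<close>

lemma matroid_basis_contract_free_iff:
  assumes A: "is_matroid A" and W: "W \<in> indep A" and C: "C \<inter> ground A = {}"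
  shows "matroid_basis (direct_sum (matroid_contract A W) (free_matroid C)) B \<longleftrightarrow>
    (\<exists>J. B = J \<union> C \<and> J \<subseteq> ground A - W \<and> matroid_basis A (J \<union> W))"
proof -
  define D where "D = direct_sum (matroid_contract A W) (free_matroid C)"
  note gr = matroid_indep_subset_ground[OF A]
  have ind: "B' \<in> indep D \<longleftrightarrow>
      (\<exists>I K. B' = I \<union> K \<and> (I \<subseteq> ground A - W \<and> I \<union> W \<in> indep A) \<and> K \<subseteq> C)" for B'
    by (simp add: D_def direct_sum_def matroid_contract_def free_matroid_def basis_in_indep[OF A W])
  have indI: "I \<union> K \<in> indep D"
    if "I \<subseteq> ground A - W" "I \<union> W \<in> indep A" "K \<subseteq> C" for I K
    unfolding ind by (rule exI[of _ I], rule exI[of _ K]) (simp add: that)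
  have grd: "ground D = (ground A - W) \<union> C"
    by (simp add: D_def direct_sum_def matroid_contract_def free_matroid_def)
  have "matroid_basis D B \<longleftrightarrow> (\<exists>J. B = J \<union> C \<and> J \<subseteq> ground A - W \<and> matroid_basis A (J \<union> W))"
  proof
    assume "matroid_basis D B"
    then have bas: "B \<in> indep D \<and> B \<subseteq> ground D \<and> (\<forall>J\<in>indep D. B \<subseteq> J \<and> J \<subseteq> ground D \<longrightarrow> J = B)"
      unfolding matroid_basis_def basis_in_def .
    \<comment> \<open>Maximality is tested only against sets containing all of \<open>C\<close>;
      applied to the part \<open>I\<close> of \<open>B\<close> itself, it shows that
      \<open>B\<close> contains \<open>C\<close>.\<close>
    have max: "I \<union> C = B" if "I \<subseteq> ground A - W" "I \<union> W \<in> indep A" "B \<subseteq> I \<union> C" for I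
    proof -
      have "I \<union> C \<subseteq> ground D" using that(1) unfolding grd by (rule Un_mono) simp
      then show ?thesis using bas indI[OF that(1,2) subset_refl] that(3) by simp
    qed
    obtain I K where B: "B = I \<union> K" and I: "I \<subseteq> ground A - W" "I \<union> W \<in> indep A" and "K \<subseteq> C"
      using bas unfolding ind by (elim exE conjE)
    then have IC: "I \<union> C = B" by (intro max) auto
    have "matroid_basis A (I \<union> W)"
      unfolding matroid_basis_def basis_in_def
    proof (intro conjI ballI impI)
      show "I \<union> W \<subseteq> ground A" by (rule gr[OF I(2)])
      fix J assume J: "J \<in> indep A" "I \<union> W \<subseteq> J \<and> J \<subseteq> ground A"
      have JW: "J - W \<union> W = J" using J(2) by blast
      have "(J - W) \<union> C = B"
        by (rule max) (use J I(1) JW in \<open>auto simp flip: IC\<close>)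
      then have eq: "(J - W) \<union> C = I \<union> C" by (simp add: IC)
      have "J - W \<subseteq> I"
      proof
        fix v assume v: "v \<in> J - W"
        then have "v \<in> I \<union> C" using eq by blast
        then show "v \<in> I" using v J(2) C by blast
      qed
      then show "J = I \<union> W" using J(2) by blast
    qed (rule I(2))
    then show "\<exists>J. B = J \<union> C \<and> J \<subseteq> ground A - W \<and> matroid_basis A (J \<union> W)"
      using I(1) IC by blast
  next
    assume "\<exists>J. B = J \<union> C \<and> J \<subseteq> ground A - W \<and> matroid_basis A (J \<union> W)"
    then obtain J where J: "B = J \<union> C" "J \<subseteq> ground A - W" and bas: "matroid_basis A (J \<union> W)"
      by (elim exE conjE)
    have JW: "J \<union> W \<in> indep A" using bas by (simp add: matroid_basis_def basis_in_def)
    have max: "I = J \<union> W" if "I \<in> indep A" "J \<union> W \<subseteq> I" for I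
      using bas that gr[OF that(1)] by (simp add: matroid_basis_def basis_in_def)
    show "matroid_basis D B"
      unfolding matroid_basis_def basis_in_def
    proof (intro conjI ballI impI)
      show "B \<in> indep D" unfolding J(1) by (rule indI[OF J(2) JW subset_refl])
      show "B \<subseteq> ground D" unfolding J(1) grd by (rule Un_mono[OF J(2) subset_refl])
      fix B' assume "B' \<in> indep D" and B': "B \<subseteq> B' \<and> B' \<subseteq> ground D"
      then obtain I K where I: "B' = I \<union> K" "I \<subseteq> ground A - W" "I \<union> W \<in> indep A" "K \<subseteq> C"
        unfolding ind by (elim exE conjE)
      have "J \<subseteq> I"
      proof
        fix v assume v: "v \<in> J"
        then have "v \<in> I \<union> K" using B' J(1) I(1) by blast
        then show "v \<in> I" using v J(2) C I(4) by blast
      qed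
      then have "I \<union> W = J \<union> W" using max[OF I(3)] by blast
      then have "I = J" using I(2) J(2) by blast
      then show "B' = B" using B' J(1) I(1,4) by blast
    qed
  qed
  then show ?thesis by (simp only: D_def)
qed

section \<open>Path components\<close>

lemma Union_path_edges:
  assumes "2 \<le> length p"
  shows "\<Union>(path_edges p) = set p"
  using assms
proof (induction p)
  case (Cons a p)
  show ?case
  proof (cases "2 \<le> length p")
    case True
    then have "p \<noteq> []" by auto
    then show ?thesis
      using Cons.IH[OF True] hd_in_set[of p] by (auto simp: path_edges_Cons simp del: hd_in_set)
  next
    case False
    then obtain b where "p = [b]" using Cons.prems by (cases p; cases "tl p") auto
    then show ?thesis by (simp add: path_edges_Cons)
  qed
qed simp

lemma length_path_ge_2:
  assumes "p \<noteq> []" "hd p \<noteq> last p"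
  shows "2 \<le> length p"
  using assms by (cases p; cases "tl p") auto

text \<open>All edges of \<open>M\<close> at a vertex of \<open>p\<close> belong to
  \<open>p\<close>, so walking along \<open>q\<close> in either direction from a common vertex never
  leaves \<open>p\<close>.\<close>

lemma path_component_absorbs:
  assumes "path_component M p" and "is_path M q" and "i < length q" and "q ! i \<in> set p"
  shows "set q \<subseteq> set p"
proof -
  have closed: "e \<subseteq> set p" if "e \<in> M" "v \<in> e" "v \<in> set p" for e v
    using assms(1) that path_edges_subset unfolding path_component_def by blast
  have edge: "{q ! k, q ! Suc k} \<in> M" if "Suc k < length q" for k
    using assms(2) that unfolding is_path_def path_edges_def by blast
  have up: "q ! (i + k) \<in> set p" if "i + k < length q" for k
    using that
  proof (induction k)
    case (Suc k)
    then show ?case using closed[OF edge[of "i + k"], of "q ! (i + k)"] by simp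
  qed (use assms in simp)
  \<comment> \<open>Truncated subtraction: once the walk has reached position 0 it stays
    there.\<close>
  have down: "q ! (i - k) \<in> set p" for k
  proof (induction k)
    case (Suc k)
    show ?case
    proof (cases "i - k")
      case 0
      then show ?thesis using Suc by simp
    next
      case (Suc m)
      then have "Suc m < length q" using assms(3) by simp
      then show ?thesis using closed[OF edge[of m], of "q ! Suc m"] Suc.IH Suc
        by (metis Suc_diff_Suc diff_Suc_Suc diff_zero insertCI insert_subset nat.inject zero_less_Suc zero_less_diff)
    qed
  qed (use assms in simp)
  show ?thesis
  proof
    fix v assume "v \<in> set q"
    then obtain k where k: "k < length q" "q ! k = v" by (metis in_set_conv_nth)
    show "v \<in> set p"
      using up[of "k - i"] down[of "i - k"] k by (cases "i \<le> k") auto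
  qed
qed

text \<open>Two components with a common vertex have the same vertices and hence the same edges. An
  end of a path lies on just one of its edges, whereas an inner vertex lies on two.\<close>

lemma path_component_unique_hd:
  assumes p: "path_component M p" and q: "path_component M q"
    and last: "last p = last q" and hl: "hd p \<noteq> last p" "hd q \<noteq> last q"
  shows "hd p = hd q"
proof -
  have path: "is_path M p" "is_path M q" using p q by (auto simp: path_component_def)
  have ne: "p \<noteq> []" "q \<noteq> []" using path by (auto simp: is_path_def)
  have "set q \<subseteq> set p"
    by (rule path_component_absorbs[OF p path(2), of "length q - 1"])
       (use path(2) ne last_in_set[OF ne(1)] last in \<open>auto simp: last_conv_nth\<close>)
  moreover have "set p \<subseteq> set q"
    by (rule path_component_absorbs[OF q path(1), of "length p - 1"])
       (use ne last_in_set[OF ne(2)] last in \<open>auto simp: last_conv_nth\<close>)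
  ultimately have eq: "set p = set q" by blast
  then have edges: "path_edges p = path_edges q" using p q by (simp add: path_component_def)
  obtain i where i: "i < length p" "p ! i = hd q" using eq ne by (metis hd_in_set in_set_conv_nth)
  \<comment> \<open>In \<open>p\<close> the vertex \<open>hd q\<close> is not the last one, so it
    has a successor. A predecessor would give it a second edge, but \<open>q\<close> has only one
    edge at its head.\<close>
  have "i \<noteq> length p - 1" using i ne hl last by (auto simp: last_conv_nth)
  then have "Suc i < length p" using i by simp
  then have up: "{p ! i, p ! Suc i} \<in> path_edges q"
    unfolding edges[symmetric] by (auto simp: path_edges_def)
  obtain b q' where q': "q = hd q # b # q'"
    using ne hl(2) by (cases q; cases "tl q") auto
  have hdq: "e = {hd q, b}" if "e \<in> path_edges q" "hd q \<in> e" for e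
  proof -
    have "path_edges q = insert {hd q, b} (path_edges (b # q'))"
      using q' path_edges_Cons[of "b # q'" "hd q"] by simp
    moreover have "hd q \<notin> set (b # q')" using path(2) q' by (metis distinct.simps(2) is_path_def)
    ultimately show ?thesis using that path_edges_subset[of e "b # q'"] by auto
  qed
  show ?thesis
  proof (cases i)
    case 0
    then show ?thesis using i ne by (simp add: hd_conv_nth)
  next
    case (Suc j)
    then have "{p ! j, p ! Suc j} \<in> path_edges q"
      using i unfolding edges[symmetric] by (auto simp: path_edges_def)
    then have "{p ! j, p ! Suc j} = {p ! i, p ! Suc i}"
      using hdq up i Suc by (metis insertI1 insert_commute)
    moreover have "distinct p" using path by (simp add: is_path_def)
    ultimately show ?thesis using Suc i \<open>Suc i < length p\<close> by (auto simp: doubleton_eq_iff nth_eq_iff_index_eq)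
  qed
qed

section \<open>Path systems and path-matchings\<close>

definition system_edges :: "'v list set \<Rightarrow> 'v set set \<Rightarrow> 'v set set" where
  "system_edges P N = (\<Union>p\<in>P. path_edges p) \<union> N"

context
  fixes F A B S and P :: "'v list set" and N
  assumes sys: "path_system F A B S P N"
    and AB: "A \<inter> B = {}" and AS: "A \<inter> S = {}" and BS: "B \<inter> S = {}"
begin

text \<open>A path with a single vertex would start and end in \<open>A \<inter> B\<close>. Having
  at least one edge, every path is covered by its edges.\<close>

lemma path_system_length:
  assumes "p \<in> P"
  shows "2 \<le> length p"
  using path_system_path[OF sys assms] AB by (intro length_path_ge_2) (auto simp: is_path_def)

lemma path_system_Union: "\<Union>(system_edges P N) = (\<Union>p\<in>P. set p) \<union> \<Union>N"
proof -
  have "(\<Union>p\<in>P. \<Union>(path_edges p)) = (\<Union>p\<in>P. set p)"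
    using Union_path_edges[OF path_system_length] by simp
  moreover have "\<Union>(system_edges P N) = (\<Union>p\<in>P. \<Union>(path_edges p)) \<union> \<Union>N"
    by (auto simp: system_edges_def)
  ultimately show ?thesis by simp
qed

lemma card_path_system: "card A = card B"
proof -
  note path = path_system_path[OF sys] and disj = path_system_disjoint[OF sys]
    and cov = path_system_covers[OF sys]
  have ne: "p \<noteq> []" if "p \<in> P" for p using path(1)[OF that] by (simp add: is_path_def)
  have "inj_on hd P"
  proof
    fix p q assume "p \<in> P" "q \<in> P" "hd p = hd q"
    then show "p = q" using disj[of p q] ne[of p] ne[of q] hd_in_set by (metis disjoint_iff)
  qed
  moreover have "inj_on last P"
  proof
    fix p q assume "p \<in> P" "q \<in> P" "last p = last q"
    then show "p = q" using disj[of p q] ne[of p] ne[of q] last_in_set by (metis disjoint_iff)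
  qed
  moreover have "A = hd ` P" "B = last ` P" using cov path(2,3) by auto
  ultimately show ?thesis by (simp add: card_image)
qed

text \<open>Along a path, the row of each vertex forces the entry of its successor to vanish, given that
  the entry of its predecessor vanishes.\<close>

lemma trivial_kernel_path_system:
  fixes Y :: "'v \<Rightarrow> 'v \<Rightarrow> 'k::field"
  assumes fin: "finite B" "finite S" and card2: "\<And>e. e \<in> N \<Longrightarrow> card e = 2"
    and supp: "\<And>a b. a \<in> A \<union> S \<Longrightarrow> b \<in> B \<union> S \<Longrightarrow> Y a b \<noteq> 0 \<longleftrightarrow> {a, b} \<in> system_edges P N"
  shows "trivial_kernel (A \<union> S) (B \<union> S) Y"
proof (rule trivial_kernelI)
  fix y assume y: "\<And>a. a \<in> A \<union> S \<Longrightarrow> (\<Sum>b\<in>B \<union> S. Y a b * y b) = 0"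
  note path = path_system_path[OF sys] and disj = path_system_disjoint[OF sys]
    and N = path_system_matching[OF sys] and cov = path_system_covers[OF sys]
    and set_p = path_system_set[OF sys AB]
  \<comment> \<open>If all other neighbours of \<open>a\<close> carry the value 0, the equation of
    row \<open>a\<close> reduces to one term with a nonzero coefficient.\<close>
  have step: "y b = 0" if "a \<in> A \<union> S" "b \<in> B \<union> S" "{a, b} \<in> system_edges P N"
    and rest: "\<And>c. c \<in> B \<union> S \<Longrightarrow> {a, c} \<in> system_edges P N \<Longrightarrow> c \<noteq> b \<Longrightarrow> y c = 0" for a b
  proof -
    have "(\<Sum>c\<in>B \<union> S. Y a c * y c) = Y a b * y b"
    proof -
      have "Y a c * y c = 0" if "c \<in> B \<union> S - {b}" for c
        using supp[of a c] rest[of c] that \<open>a \<in> A \<union> S\<close> by auto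
      then have "(\<Sum>c\<in>B \<union> S - {b}. Y a c * y c) = 0" by (rule sum.neutral[OF ballI])
      then show ?thesis using fin that(2) by (simp only: sum.remove[of _ b] finite_Un) simp
    qed
    then show ?thesis using y[OF that(1)] supp[OF that(1,2)] that(3) by simp
  qed
  have on_path: "y (p ! Suc k) = 0" if p: "p \<in> P" and "Suc k < length p" for p k
    using that(2)
  proof (induction k rule: less_induct)
    case (less k)
    have dist: "distinct p" using path(1)[OF p] by (simp add: is_path_def)
    have hd: "p ! 0 = hd p" using less.prems by (cases p) auto
    have last: "p ! (length p - 1) = last p" using less.prems by (cases p) (auto simp: last_conv_nth)
    have vs: "p ! i \<in> insert (hd p) (insert (last p) (set (butlast (tl p))))" if "i < length p" for i
      using set_p[OF p] that nth_mem by blast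
    have ne_hd: "p ! i \<noteq> hd p" if "0 < i" "i < length p" for i
      using dist hd that by (metis nth_eq_iff_index_eq less_trans not_less_zero neq0_conv)
    have ne_last: "p ! i \<noteq> last p" if "Suc i < length p" for i
    proof -
      have "i < length p" "length p - 1 < length p" "i \<noteq> length p - 1" using that by auto
      then show ?thesis using dist last nth_eq_iff_index_eq by metis
    qed
    have row: "p ! k \<in> A \<union> S"
      using vs[of k] ne_last[OF less.prems] less.prems path(2,4)[OF p] by auto
    have col: "p ! Suc k \<in> B \<union> S"
      using vs[OF less.prems] ne_hd[OF _ less.prems] path(3,4)[OF p] by auto
    have "{p ! k, p ! Suc k} \<in> path_edges p" using less.prems by (auto simp: path_edges_def)
    then have edge: "{p ! k, p ! Suc k} \<in> system_edges P N" using p by (auto simp: system_edges_def)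
    show ?case
    proof (rule step[OF row col edge])
      fix c assume c: "c \<in> B \<union> S" "{p ! k, c} \<in> system_edges P N" "c \<noteq> p ! Suc k"
      have pk: "p ! k \<in> set p" using less.prems by simp
      from c(2) consider q where "q \<in> P" "{p ! k, c} \<in> path_edges q" | "{p ! k, c} \<in> N"
        by (auto simp: system_edges_def)
      then show "y c = 0"
      proof cases
        case 1
        then have "p ! k \<in> set q" using path_edges_subset by blast
        then have "q = p" using disj[OF 1(1) p] pk by blast
        then obtain i where i: "Suc i < length p" "{p ! k, c} = {p ! i, p ! Suc i}"
          using 1(2) by (auto simp: path_edges_def)
        then have "k = Suc i" "c = p ! i"
          using c(3) dist less.prems by (auto simp: doubleton_eq_iff nth_eq_iff_index_eq)
        show ?thesis
        proof (cases i)
          case 0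
          \<comment> \<open>The predecessor is the start of the path, which lies in \<open>A\<close>
            and has no column; this is where the forcing begins.\<close>
          then have "c \<in> A" using \<open>c = p ! i\<close> hd path(2)[OF p] by simp
          then show ?thesis using c(1) AB AS by blast
        next
          case (Suc j)
          then show ?thesis using less.IH[of j] \<open>k = Suc i\<close> \<open>c = p ! i\<close> i by simp
        qed
      next
        case 2
        then show ?thesis using N(4)[OF 2 p] pk by blast
      qed
    qed
  qed
  have on_paths: "y b = 0" if p: "p \<in> P" "b \<in> set p" "b \<notin> A" for b p
  proof -
    obtain i where i: "i < length p" "p ! i = b" using p(2) by (metis in_set_conv_nth)
    have "p ! 0 \<in> A" using path(2)[OF p(1)] i by (cases p) auto
    then obtain k where "i = Suc k" using p(3) i by (cases i) auto
    then show ?thesis using on_path[OF p(1), of k] i by simp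
  qed
  have on_matching: "y b = 0" if e: "e \<in> N" "b \<in> e" for b e
  proof -
    obtain a where a: "e = {a, b}" "a \<noteq> b"
      using card2[OF e(1)] e(2) by (metis card_2_iff insert_iff insert_commute singletonD)
    have ab: "a \<in> S" "b \<in> S" using N(3)[OF e(1)] a by auto
    \<comment> \<open>The row of the partner \<open>a\<close> contains \<open>b\<close> as its only
      nonzero column, because \<open>a\<close> lies on no path and on no other edge of
      \<open>N\<close>.\<close>
    show ?thesis
    proof (rule step)
      show "{a, b} \<in> system_edges P N" using e a by (simp add: system_edges_def)
      fix c assume c: "{a, c} \<in> system_edges P N" "c \<noteq> b"
      then consider q where "q \<in> P" "{a, c} \<in> path_edges q" | "{a, c} \<in> N"
        by (auto simp: system_edges_def)
      then show "y c = 0"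
      proof cases
        case 1
        then have "a \<in> set q" using path_edges_subset by blast
        then show ?thesis using N(4)[OF e(1) 1(1)] a by blast
      next
        case 2
        have "{a, c} = e" using N(2) 2 e(1) a by (metis disjointD disjoint_iff insertI1)
        then show ?thesis using a c(2) by (auto simp: doubleton_eq_iff)
      qed
    qed (use ab in blast)+
  qed
  show "\<forall>b\<in>B \<union> S. y b = 0"
  proof
    fix b assume b: "b \<in> B \<union> S"
    then have "b \<notin> A" using AB AS by blast
    have "b \<in> (\<Union>p\<in>P. set p) \<union> \<Union>N"
    proof (cases "b \<in> B")
      case True
      then obtain p where "p \<in> P" "last p = b" using cov(2) by blast
      then have "b \<in> set p" using path_system_length[of p] by (cases p) auto
      then show ?thesis using \<open>p \<in> P\<close> by blast
    next
      case False
      then have "b \<in> S" using b by simp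
      then show ?thesis using cov(3) by (rule subsetD[rotated])
    qed
    then show "y b = 0" using on_paths[OF _ _ \<open>b \<notin> A\<close>] on_matching by blast
  qed
qed

lemma path_matching_of_path_system:
  assumes F: "F = EE H" and "A \<subseteq> T1 H" and "B \<subseteq> T2 H" and S: "S = SS H"
    and disj: "T1 H \<inter> T2 H = {}" "T1 H \<inter> SS H = {}" "T2 H \<inter> SS H = {}"
  shows "path_matching H (system_edges P N)"
    and "covered (T1 H) (system_edges P N) = A"
    and "covered (T2 H) (system_edges P N) = B"
    and "covered (SS H) (system_edges P N) = SS H"
proof -
  note path = path_system_path[OF sys] and N = path_system_matching[OF sys]
    and cov = path_system_covers[OF sys] and set_p = path_system_set[OF sys AB]
    and sub = path_system_subset[OF sys AB]
  show "path_matching H (system_edges P N)"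
    unfolding path_matching_def
  proof (intro exI conjI)
    show "\<forall>p\<in>P. is_path (EE H) p \<and> hd p \<in> T1 H \<and> last p \<in> T2 H \<and> set (butlast (tl p)) \<subseteq> SS H"
      using path assms(1-4) by blast
    show "disjoint_family_on set P" using sys by (simp add: path_system_def)
    show "\<forall>e\<in>N. e \<subseteq> SS H - (\<Union>p\<in>P. set p)" using N(3,4) S by blast
  qed (use N(1,2) F in \<open>simp_all add: system_edges_def\<close>)
  have covd: "covered W (system_edges P N) = W \<inter> \<Union>(system_edges P N)" for W
    by (auto simp: covered_def)
  have UN: "\<Union>N \<subseteq> S" using N(3) by blast
  have UP: "(\<Union>p\<in>P. set p) \<subseteq> A \<union> B \<union> S" using sub by blast
  have "hd ` P \<subseteq> (\<Union>p\<in>P. set p)" "last ` P \<subseteq> (\<Union>p\<in>P. set p)"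
    using set_p by auto
  then have AU: "A \<subseteq> (\<Union>p\<in>P. set p)" "B \<subseteq> (\<Union>p\<in>P. set p)" using cov(1,2) by auto
  show "covered (T1 H) (system_edges P N) = A"
    unfolding covd path_system_Union using UN UP AU(1) assms(2-4) disj(1,2) by blast
  show "covered (T2 H) (system_edges P N) = B"
    unfolding covd path_system_Union using UN UP AU(2) assms(2-4) disj(1,3) by blast
  show "covered (SS H) (system_edges P N) = SS H"
    unfolding covd path_system_Union using cov(3) S by blast
qed

end

lemma path_system_of_path_matching:
  assumes K: "path_matching H K" and cov: "covered (SS H) K = SS H"
    and disj: "T1 H \<inter> T2 H = {}" "T1 H \<inter> SS H = {}" "T2 H \<inter> SS H = {}"
  obtains P N where "path_system (EE H) (covered (T1 H) K) (covered (T2 H) K) (SS H) P N"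
    and "K = system_edges P N"
proof -
  obtain P N where PN': "\<forall>p\<in>P. is_path (EE H) p \<and> hd p \<in> T1 H \<and> last p \<in> T2 H \<and>
        set (butlast (tl p)) \<subseteq> SS H"
      "disjoint_family_on set P" "N \<subseteq> EE H" "disjoint N" "\<forall>e\<in>N. e \<subseteq> SS H - (\<Union>p\<in>P. set p)"
    and K: "K = system_edges P N"
    using K unfolding path_matching_def system_edges_def by (elim exE conjE)
  note PN = bspec[OF PN'(1)] PN'(2-4) bspec[OF PN'(5)]
  have len: "2 \<le> length p" and set_p: "set p = insert (hd p) (insert (last p) (set (butlast (tl p))))"
    if "p \<in> P" for p
    using PN(1)[OF that] disj(1) by (auto intro!: length_path_ge_2 set_path_split simp: is_path_def)
  have UK: "\<Union>K = (\<Union>p\<in>P. set p) \<union> \<Union>N"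
  proof -
    have "(\<Union>p\<in>P. \<Union>(path_edges p)) = (\<Union>p\<in>P. set p)" using Union_path_edges[OF len] by simp
    moreover have "\<Union>K = (\<Union>p\<in>P. \<Union>(path_edges p)) \<union> \<Union>N"
      by (auto simp: K system_edges_def)
    ultimately show ?thesis by simp
  qed
  have covd: "covered W K = W \<inter> \<Union>K" for W by (auto simp: covered_def)
  have inK: "set p \<subseteq> \<Union>K" if "p \<in> P" for p unfolding UK using that by blast
  have UN: "\<Union>N \<subseteq> SS H" using PN(5) by blast
  have "path_system (EE H) (covered (T1 H) K) (covered (T2 H) K) (SS H) P N"
  proof (rule path_systemI)
    fix p assume p: "p \<in> P"
    show "is_path (EE H) p" "set (butlast (tl p)) \<subseteq> SS H" using PN(1)[OF p] by auto
    show "hd p \<in> covered (T1 H) K" "last p \<in> covered (T2 H) K"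
      unfolding covd using PN(1)[OF p] inK[OF p] set_p[OF p] by auto
    fix q assume "q \<in> P" "p \<noteq> q"
    then show "set p \<inter> set q = {}" using PN(2) p by (simp add: disjoint_family_on_def)
  next
    fix e p assume "e \<in> N" "p \<in> P"
    then show "e \<inter> set p = {}" using PN(5) by blast
  next
    fix e assume "e \<in> N"
    then show "e \<subseteq> SS H" using PN(5) by blast
  next
    show "covered (T1 H) K \<subseteq> hd ` P"
    proof
      fix v assume v: "v \<in> covered (T1 H) K"
      then obtain p where p: "p \<in> P" "v \<in> set p" using UN disj(2) unfolding covd UK by blast
      \<comment> \<open>The last vertex lies in \<open>T2 H\<close> and the inner ones in
        \<open>SS H\<close>, so a vertex of \<open>T1 H\<close> on a path can only be its
        head.\<close>
      then have "v = hd p" using v PN(1)[OF p(1)] set_p[OF p(1)] disj(1,2) unfolding covd by auto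
      then show "v \<in> hd ` P" using p by blast
    qed
    show "covered (T2 H) K \<subseteq> last ` P"
    proof
      fix v assume v: "v \<in> covered (T2 H) K"
      then obtain p where p: "p \<in> P" "v \<in> set p" using UN disj(3) unfolding covd UK by blast
      then have "v = last p" using v PN(1)[OF p(1)] set_p[OF p(1)] disj(1,3) unfolding covd by auto
      then show "v \<in> last ` P" using p by blast
    qed
    show "SS H \<subseteq> (\<Union>p\<in>P. set p) \<union> \<Union>N" using cov unfolding covd UK by blast
  qed (use PN(3,4) in auto)
  then show thesis using that K by blast
qed


section \<open>Blocks of a matrix\<close>

text \<open>A determinant is affine in each entry: if it is nonzero, then so is the minor belonging to
  that entry or the determinant with the entry replaced by 0.\<close>

lemma nonsingular_clear_entries:
  fixes A :: "'i \<Rightarrow> 'j \<Rightarrow> 'k::field"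
  assumes "finite D" and "nonsingular R C A" and "D \<subseteq> R \<times> C" and "inj_on fst D" and "inj_on snd D"
  shows "\<exists>K\<subseteq>D. nonsingular (R - fst ` K) (C - snd ` K) (\<lambda>i j. if (i, j) \<in> D then 0 else A i j)"
  using assms
proof (induction D arbitrary: R C A rule: finite_induct)
  case empty
  then show ?case by simp
next
  case (insert p D)
  obtain a b where p: "p = (a, b)" by fastforce
  have ab: "a \<in> R" "b \<in> C" using insert.prems(2) p by auto
  have inj: "inj_on fst D" "inj_on snd D" and new: "a \<notin> fst ` D" "b \<notin> snd ` D"
    using insert.prems(3,4) insert.hyps(2) p by auto
  from nonsingular_clear_entry[OF insert.prems(1) ab] show ?case
  proof
    assume ns: "nonsingular (R - {a}) (C - {b}) A"
    have "D \<subseteq> (R - {a}) \<times> (C - {b})" using insert.prems(2) new by force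
    from insert.IH[OF ns this inj] obtain K where K: "K \<subseteq> D"
      "nonsingular (R - {a} - fst ` K) (C - {b} - snd ` K) (\<lambda>i j. if (i, j) \<in> D then 0 else A i j)"
      by blast
    have "R - fst ` insert p K = R - {a} - fst ` K" "C - snd ` insert p K = C - {b} - snd ` K"
      using p by auto
    \<comment> \<open>Row \<open>a\<close> has been deleted, so clearing the entry at
      \<open>p\<close> as well changes nothing in the remaining matrix.\<close>
    moreover have "nonsingular (R - {a} - fst ` K) (C - {b} - snd ` K)
        (\<lambda>i j. if (i, j) \<in> insert p D then 0 else A i j)"
    proof -
      have "trivial_kernel (R - {a} - fst ` K) (C - {b} - snd ` K)
          (\<lambda>i j. if (i, j) \<in> insert p D then 0 else A i j)"
      proof (rule trivial_kernelI)
        fix v assume v: "\<And>i. i \<in> R - {a} - fst ` K \<Longrightarrow>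
          (\<Sum>j\<in>C - {b} - snd ` K. (if (i, j) \<in> insert p D then 0 else A i j) * v j) = 0"
        have "(\<Sum>j\<in>C - {b} - snd ` K. (if (i, j) \<in> D then 0 else A i j) * v j) = 0"
          if i: "i \<in> R - {a} - fst ` K" for i
          using v[OF i] i by (simp add: p)
        then show "\<forall>j\<in>C - {b} - snd ` K. v j = 0"
          using trivial_kernelD[OF nonsingular_trivial_kernel[OF K(2)]] by blast
      qed
      then show ?thesis
        using nonsingular_imp_finite_card[OF K(2)] nonsingular_iff_trivial_kernel by blast
    qed
    ultimately show ?thesis using K(1) by (intro exI[of _ "insert p K"]) auto
  next
    assume "nonsingular R C (\<lambda>i j. if i = a \<and> j = b then 0 else A i j)"
    from insert.IH[OF this _ inj] insert.prems(2) obtain K where K: "K \<subseteq> D" and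
      ns: "nonsingular (R - fst ` K) (C - snd ` K)
        (\<lambda>i j. if (i, j) \<in> D then 0 else if i = a \<and> j = b then 0 else A i j)"
      by auto
    have "(\<lambda>i j. if (i, j) \<in> D then 0 else if i = a \<and> j = b then 0 else A i j) =
        (\<lambda>i j. if (i, j) \<in> insert p D then 0 else A i j)"
      by (intro ext) (auto simp: p)
    with K ns show ?thesis by (intro exI[of _ K]) auto
  qed
qed

text \<open>Relabels tagged block indices as vertices. Repeated rows do not change a kernel but
  repeated columns do, hence injectivity is asked of the column map.\<close>

lemma trivial_kernel_image:
  assumes "inj_on g C" and "\<And>i j. i \<in> R \<Longrightarrow> j \<in> C \<Longrightarrow> A (f i) (g j) = B i j"
  shows "trivial_kernel (f ` R) (g ` C) A \<longleftrightarrow> trivial_kernel R C B"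
proof -
  have sum: "(\<Sum>j\<in>g ` C. A (f i) j * v j) = (\<Sum>j\<in>C. B i j * v (g j))" if "i \<in> R" for i v
    using assms(2)[OF that] by (simp add: sum.reindex[OF assms(1)])
  show ?thesis
  proof
    assume tk: "trivial_kernel (f ` R) (g ` C) A"
    show "trivial_kernel R C B"
    proof (rule trivial_kernelI)
      fix v assume v: "\<And>i. i \<in> R \<Longrightarrow> (\<Sum>j\<in>C. B i j * v j) = 0"
      define w where "w = v \<circ> inv_into C g"
      have wg: "w (g j) = v j" if "j \<in> C" for j using assms(1) that by (simp add: w_def)
      have "(\<Sum>j\<in>g ` C. A i j * w j) = 0" if "i \<in> f ` R" for i
      proof -
        obtain k where k: "k \<in> R" "i = f k" using \<open>i \<in> f ` R\<close> by blast
        then show ?thesis using v[OF k(1)] by (simp add: sum wg cong: sum.cong)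
      qed
      then have "w j = 0" if "j \<in> g ` C" for j using trivial_kernelD[OF tk] that by blast
      then show "\<forall>j\<in>C. v j = 0" using wg by (metis imageI)
    qed
  next
    assume tk: "trivial_kernel R C B"
    show "trivial_kernel (f ` R) (g ` C) A"
    proof (rule trivial_kernelI)
      fix v assume v: "\<And>i. i \<in> f ` R \<Longrightarrow> (\<Sum>j\<in>g ` C. A i j * v j) = 0"
      have "(\<Sum>j\<in>C. B i j * v (g j)) = 0" if "i \<in> R" for i
        using v[of "f i"] that sum[OF that, of v] by simp
      then have "v (g j) = 0" if "j \<in> C" for j
        using trivial_kernelD[OF tk, of "\<lambda>j. v (g j)"] that by blast
      then show "\<forall>j\<in>g ` C. v j = 0" by blast
    qed
  qed
qed

section \<open>Descent to the base field and specialisation of rational functions\<close>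

lemma lin_indep_family_iff_trivial_kernel:
  "lin_indep_family r J v \<longleftrightarrow> trivial_kernel {..<r} J (\<lambda>i j. v j i)"
  by (simp add: lin_indep_family_def trivial_kernel_def mult.commute Ball_def)

text \<open>A dependency over the base field remains one over the rational functions, so triviality
  of the kernel descends.\<close>

lemma trivial_kernel_const:
  fixes A :: "'i \<Rightarrow> 'j \<Rightarrow> 'f::field"
  assumes "trivial_kernel R C (\<lambda>i j. const (A i j) :: ('x::linorder, 'f) ratfun)"
  shows "trivial_kernel R C A"
proof (rule trivial_kernelI)
  fix v assume v: "\<And>i. i \<in> R \<Longrightarrow> (\<Sum>j\<in>C. A i j * v j) = 0"
  have "(\<Sum>j\<in>C. const (A i j) * const (v j) :: ('x, 'f) ratfun) = 0" if "i \<in> R" for i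
  proof -
    have "(\<Sum>j\<in>C. const (A i j) * const (v j) :: ('x, 'f) ratfun) = const (\<Sum>j\<in>C. A i j * v j)"
      by (simp add: const_sum const_mult)
    then show ?thesis using v[OF that] by simp
  qed
  then have "(const (v j) :: ('x, 'f) ratfun) = 0" if "j \<in> C" for j
    using trivial_kernelD[OF assms, of "\<lambda>j. const (v j)"] that by blast
  then show "\<forall>j\<in>C. v j = 0" by simp
qed

text \<open>\<open>spec\<close> on rational functions that are polynomials, with junk values elsewhere.\<close>

definition spec_frac :: "'x set \<Rightarrow> ('x::linorder, 'f::field) ratfun \<Rightarrow> 'f" where
  "spec_frac U q = spec U (inv_into UNIV to_fract q)"

lemma spec_frac_to_fract [simp]: "spec_frac U (to_fract p) = spec U p"
  by (simp add: spec_frac_def inv_f_f inj_def)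

lemma spec_frac_0 [simp]: "spec_frac U 0 = 0"
  using spec_frac_to_fract[of U 0] by (simp add: spec_zero)

lemma spec_frac_const [simp]: "spec_frac U (const c) = c"
  by (simp add: const_eq spec_single)

lemma spec_frac_indet [simp]: "spec_frac U (indet n) = (if n \<in> U then 1 else 0)"
  by (simp add: indet_eq spec_single)

lemma spec_frac_minus_indet [simp]: "spec_frac U (- indet n) = (if n \<in> U then - 1 else 0)"
proof -
  have eq: "- indet n = to_fract (Poly_Mapping.single (Poly_Mapping.single n 1) (- 1))"
    by (simp add: indet_eq single_uminus)
  show ?thesis by (simp only: eq spec_frac_to_fract) (simp add: spec_single)
qed

text \<open>\<open>Z_entry\<close> takes values in the fraction field. Choosing polynomial preimages
  of its entries makes specialisation applicable.\<close>

lemma nonsingular_if_spec_frac: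
  assumes ns: "nonsingular R C (\<lambda>i j. spec_frac U (A i j))"
    and pol: "\<And>i j. i \<in> R \<Longrightarrow> j \<in> C \<Longrightarrow> A i j \<in> range to_fract"
  shows "nonsingular R C A"
proof -
  note fin = nonsingular_imp_finite_card[OF ns]
  have "nonsingular R C (\<lambda>i j. to_fract (inv_into UNIV to_fract (A i j)))"
    using ns by (intro nonsingular_if_spec[of _ _ U]) (simp add: spec_frac_def)
  then have "trivial_kernel R C (\<lambda>i j. to_fract (inv_into UNIV to_fract (A i j)))"
    by (rule nonsingular_trivial_kernel)
  then have "trivial_kernel (id ` R) (id ` C) A"
    by (subst trivial_kernel_image) (use pol in \<open>auto simp: f_inv_into_f\<close>)
  then show ?thesis using fin by (simp add: nonsingular_iff_trivial_kernel)
qed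

lemma range_to_fract_simps [simp]:
  "0 \<in> range to_fract" "const c \<in> range to_fract" "indet n \<in> range to_fract"
  "- indet n \<in> range to_fract"
  by (metis rangeI to_fract_0, metis rangeI const_eq, metis rangeI indet_eq,
      metis rangeI indet_eq to_fract_uminus)

section \<open>Sums and cardinalities over tagged blocks\<close>

lemma sum_blocks:
  fixes f :: "'v zindex \<Rightarrow> 'a::comm_monoid_add"
  assumes "finite I" "finite A" "finite B" "finite C" "finite D"
  shows "sum f (Blk1 ` I \<union> Blk2 ` A \<union> Blk3 ` B \<union> Blk4 ` C \<union> Blk5 ` D) =
    (\<Sum>i\<in>I. f (Blk1 i)) + (\<Sum>v\<in>A. f (Blk2 v)) + (\<Sum>v\<in>B. f (Blk3 v)) + (\<Sum>v\<in>C. f (Blk4 v)) +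
    (\<Sum>v\<in>D. f (Blk5 v))"
  using assms
  by (subst sum.union_disjoint; (auto simp: sum.reindex inj_on_def; fail)?)+

lemma card_blocks:
  assumes "finite I" "finite A" "finite B" "finite C" "finite D"
  shows "card (Blk1 ` I \<union> Blk2 ` A \<union> Blk3 ` B \<union> Blk4 ` C \<union> Blk5 ` D) =
    card I + card A + card B + card C + card D"
  by (simp only: card_eq_sum sum_blocks[OF assms])

section \<open>The contracted instance\<close>

lemma path_ends_subset_covered:
  assumes "T \<inter> S = {}"
  shows "path_ends T S M \<subseteq> covered S M"
proof
  fix v assume "v \<in> path_ends T S M"
  then obtain p where p: "path_component M p" "hd p \<in> T" "last p = v" "v \<in> S"
    by (auto simp: path_ends_def)
  then have path: "is_path M p" by (simp add: path_component_def)
  then have ne: "p \<noteq> []" by (simp add: is_path_def)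
  have "hd p \<noteq> last p" using p assms by auto
  then have "v \<in> \<Union>(path_edges p)"
    using Union_path_edges[OF length_path_ge_2[OF ne]] p(3) ne by auto
  then show "v \<in> covered S M" using path p(4) by (auto simp: covered_def is_path_def)
qed

text \<open>A common end in \<open>S\<close> would force the two path components to have the same
  start, which cannot lie in both \<open>T\<close> and \<open>T'\<close>. For the contracted
  instance this makes \<open>T1 H\<close> and \<open>T2 H\<close> disjoint.\<close>

lemma path_ends_disjoint:
  assumes "T \<inter> T' = {}" "T \<inter> S = {}" "T' \<inter> S = {}"
  shows "path_ends T S M \<inter> path_ends T' S M = {}"
proof (rule ccontr)
  assume "path_ends T S M \<inter> path_ends T' S M \<noteq> {}"
  then obtain p q where pq: "path_component M p" "hd p \<in> T" "last p \<in> S" "path_component M q"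
    "hd q \<in> T'" "last p = last q"
    by (auto simp: path_ends_def)
  have "hd p \<noteq> last p" "hd q \<noteq> last q" using pq assms(2,3) by auto
  then have "hd p = hd q" using pq by (intro path_component_unique_hd)
  then show False using pq assms(1) by auto
qed


locale contraction =
  fixes G :: "'v bpm_inst" and t r :: nat
    and Q1 :: "nat \<Rightarrow> 'v \<Rightarrow> 'f::field" and Q2 :: "'v \<Rightarrow> nat \<Rightarrow> 'f"
    and M :: "'v set set"
    and x :: "'v set \<Rightarrow> 'x::linorder" and d :: "'v \<Rightarrow> 'x"
    and X :: "'v \<Rightarrow> 'v \<Rightarrow> ('x, 'f) ratfun"
  assumes inst: "bpm_instance t r G"
    and rep1: "represents r (\<lambda>v i. Q1 i v) (MM1 G)"
    and rep2: "represents r (\<lambda>v j. Q2 v j) (MM2 G)"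
    and cov1_indep: "cov1 G M \<in> indep (MM1 G)"
    and cov2_indep: "cov2 G M \<in> indep (MM2 G)"
    and inj_x: "inj_on x (EE G)"
    and inj_d: "inj_on d (unc1 G M \<union> unc2 G M)"
    and x_d_disjoint: "x ` EE G \<inter> d ` (unc1 G M \<union> unc2 G M) = {}"
    and X_matrix: "is_X_matrix G x X"
begin

abbreviation "K1 \<equiv> cov1 G M"
abbreviation "K2 \<equiv> cov2 G M"
abbreviation "U1 \<equiv> unc1 G M"
abbreviation "U2 \<equiv> unc2 G M"
abbreviation "E1 \<equiv> C1 G M"
abbreviation "E2 \<equiv> C2 G M"
abbreviation "S0 \<equiv> S' G M"
abbreviation "H \<equiv> contract G M"

lemma finite_sets [simp]: "finite (T1 G)" "finite (T2 G)" "finite (SS G)"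
  and T_disjoint: "T1 G \<inter> T2 G = {}" "T1 G \<inter> SS G = {}" "T2 G \<inter> SS G = {}"
  and card_T: "card (T1 G) = t" "card (T2 G) = t"
  and card_edge: "\<And>e. e \<in> EE G \<Longrightarrow> card e = 2"
  and MM1: "is_matroid (MM1 G)" "ground (MM1 G) = T1 G" "matroid_rank (MM1 G) = r"
  and MM2: "is_matroid (MM2 G)" "ground (MM2 G) = T2 G" "matroid_rank (MM2 G) = r"
  using inst by (simp_all add: bpm_instance_def)

lemma T_split: "T1 G = K1 \<union> U1" "T2 G = K2 \<union> U2" "K1 \<inter> U1 = {}" "K2 \<inter> U2 = {}"
  by (auto simp: unc1_def unc2_def cov1_def cov2_def covered_def)

lemma E_subset: "E1 \<subseteq> covered (SS G) M" "E2 \<subseteq> covered (SS G) M"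
  using path_ends_subset_covered T_disjoint(2,3) by (auto simp: C1_def C2_def)

lemma S_split: "E1 \<subseteq> SS G" "E2 \<subseteq> SS G" "S0 \<subseteq> SS G" "E1 \<inter> E2 = {}" "E1 \<inter> S0 = {}" "E2 \<inter> S0 = {}"
proof -
  show "E1 \<inter> E2 = {}"
    unfolding C1_def C2_def by (rule path_ends_disjoint) (use T_disjoint in auto)
qed (use E_subset in \<open>auto simp: S'_def covered_def\<close>)

lemma finite_parts [simp]: "finite K1" "finite K2" "finite U1" "finite U2" "finite E1" "finite E2" "finite S0"
  using finite_subset[OF S_split(1)] finite_subset[OF S_split(2)] finite_subset[OF S_split(3)]
    finite_sets(1,2) unfolding T_split by simp_all

lemma contract_simps [simp]:
  "T1 H = U1 \<union> E1" "T2 H = U2 \<union> E2" "SS H = S0" "EE H = E' G M"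
  by (simp_all add: contract_def T1'_def T2'_def)

lemma H_disjoint: "T1 H \<inter> T2 H = {}" "T1 H \<inter> SS H = {}" "T2 H \<inter> SS H = {}"
  using T_disjoint T_split(1,2) S_split by auto

lemma E'_subset: "E' G M \<subseteq> EE G"
  by (auto simp: E'_def)

lemma E'I:
  assumes "{a, b} \<in> EE G" "a \<in> U1 \<union> E1 \<union> S0" "b \<in> U2 \<union> E2 \<union> S0"
  shows "{a, b} \<in> E' G M"
proof -
  have "{a, b} \<subseteq> S0 \<or> (a \<in> T1' G M \<and> b \<in> S0 \<union> T2' G M) \<or> (b \<in> T2' G M \<and> a \<in> S0 \<union> T1' G M)"
    using assms(2,3) by (auto simp: T1'_def T2'_def)
  then show ?thesis
    unfolding E'_def using assms(1) by (auto intro: exI[of _ b] exI[of _ a] simp: insert_commute)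
qed

lemma basis_contract1:
  "matroid_basis (MM1 H) B \<longleftrightarrow> (\<exists>J. B = J \<union> E1 \<and> J \<subseteq> U1 \<and> J \<union> K1 \<in> indep (MM1 G) \<and> card (J \<union> K1) = r)"
proof -
  have "E1 \<inter> ground (MM1 G) = {}" using S_split(1) T_disjoint(2) MM1(2) by auto
  then show ?thesis
    using matroid_basis_contract_free_iff[OF MM1(1) cov1_indep, of E1 B]
    by (simp add: contract_def matroid_basis_iff[OF MM1(1)] MM1(2,3) unc1_def)
qed

lemma basis_contract2:
  "matroid_basis (MM2 H) B \<longleftrightarrow> (\<exists>J. B = J \<union> E2 \<and> J \<subseteq> U2 \<and> J \<union> K2 \<in> indep (MM2 G) \<and> card (J \<union> K2) = r)"
proof -
  have "E2 \<inter> ground (MM2 G) = {}" using S_split(2) T_disjoint(3) MM2(2) by auto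
  then show ?thesis
    using matroid_basis_contract_free_iff[OF MM2(1) cov2_indep, of E2 B]
    by (simp add: contract_def matroid_basis_iff[OF MM2(1)] MM2(2,3) unc2_def)
qed

lemma indep_iff1: "J \<subseteq> T1 G \<Longrightarrow> J \<in> indep (MM1 G) \<longleftrightarrow> trivial_kernel {..<r} J Q1"
  using rep1 unfolding represents_def lin_indep_family_iff_trivial_kernel MM1(2) by simp

lemma indep_iff2: "J \<subseteq> T2 G \<Longrightarrow> J \<in> indep (MM2 G) \<longleftrightarrow> trivial_kernel {..<r} J (\<lambda>j u. Q2 u j)"
  using rep2 unfolding represents_def lin_indep_family_iff_trivial_kernel MM2(2) by simp

lemma X_entry:
  assumes "a \<in> T1 G \<union> SS G" "b \<in> T2 G \<union> SS G"
  shows "{a, b} \<in> EE G \<Longrightarrow> X a b = indet (x {a, b}) \<or> X a b = - indet (x {a, b})"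
    and "{a, b} \<notin> EE G \<Longrightarrow> X a b = 0"
proof -
  have "if {a, b} \<in> EE G then X a b = indet (x {a, b}) \<or> X a b = - indet (x {a, b})
      else X a b = 0"
    using X_matrix assms unfolding is_X_matrix_def by blast
  then show "{a, b} \<in> EE G \<Longrightarrow> X a b = indet (x {a, b}) \<or> X a b = - indet (x {a, b})"
    and "{a, b} \<notin> EE G \<Longrightarrow> X a b = 0" by simp_all
qed

lemma X_skew: "a \<in> SS G \<Longrightarrow> b \<in> SS G \<Longrightarrow> X b a = - X a b"
  using X_matrix unfolding is_X_matrix_def by blast

text \<open>A loop is not a two-element edge. In characteristic 2 this could not be deduced from
  \<open>X_skew\<close>.\<close>

lemma X_diag: "a \<in> SS G \<Longrightarrow> X a a = 0"
  using X_entry(2)[of a a] card_edge[of "{a, a}"] by auto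

lemma row_col_sets:
  "U1 \<subseteq> T1 G" "U2 \<subseteq> T2 G" "K1 \<subseteq> T1 G" "K2 \<subseteq> T2 G"
  using T_split by auto

subsection \<open>From nonsingularity to a basic path-matching\<close>

lemma ex_bpm_if_nonsingular:
  assumes ns: "nonsingular (Z_rows G r M) (Z_cols G r M) (Z_entry Q1 Q2 d X)"
  shows "\<exists>N. bpm H N"
proof -
  \<comment> \<open>The diagonal positions of \<open>D1\<close> and \<open>D2\<close>. Each row and
    each column contains at most one of them.\<close>
  define D where "D = (\<lambda>v. (Blk4 v, Blk3 v)) ` U1 \<union> (\<lambda>v. (Blk3 v, Blk4 v)) ` U2"
  have "finite D" by (simp add: D_def)
  moreover have "D \<subseteq> Z_rows G r M \<times> Z_cols G r M" by (auto simp: D_def Z_rows_def Z_cols_def)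
  moreover have "inj_on fst D" "inj_on snd D" by (auto simp: D_def inj_on_def)
  ultimately obtain K where K: "K \<subseteq> D" and
    ns': "nonsingular (Z_rows G r M - fst ` K) (Z_cols G r M - snd ` K)
      (\<lambda>i j. if (i, j) \<in> D then 0 else Z_entry Q1 Q2 d X i j)"
    using nonsingular_clear_entries[OF _ ns] by blast
  define R where "R = Z_rows G r M - fst ` K"
  define C where "C = Z_cols G r M - snd ` K"
  define W where "W i j = (if (i, j) \<in> D then 0 else Z_entry Q1 Q2 d X i j)" for i j
  have nsW: "nonsingular R C W" using ns' unfolding R_def C_def W_def .
  note finRC = nonsingular_imp_finite_card[OF nsW]
  note tkW = nonsingular_trivial_kernel[OF nsW]
  note tkW' = nonsingular_trivial_kernel[OF nonsingular_transpose[OF nsW]]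
  \<comment> \<open>Expanding at a diagonal entry of \<open>D1\<close> removes a column of
    \<open>Q1\<close> and the row of \<open>X\<close> for the same vertex. Hence one set
    \<open>J1\<close> indexes both the columns of \<open>Q1\<close> and the rows of \<open>X\<close>
    that survive: the vertices completing a basis are those where paths start. \<open>J2\<close> is
    analogous.\<close>
  define J1 where "J1 = {v \<in> U1. (Blk4 v, Blk3 v) \<notin> K}"
  define J2 where "J2 = {v \<in> U2. (Blk3 v, Blk4 v) \<notin> K}"
  have J: "J1 \<subseteq> U1" "J2 \<subseteq> U2" by (auto simp: J1_def J2_def)
  then have finJ [simp]: "finite J1" "finite J2" using finite_subset finite_parts(3,4) by blast+
  \<comment> \<open>The tags of a vertex in the blocks of \<open>Q1\<close> and \<open>Q2\<close>
    (\<open>b1\<close>, \<open>b2\<close>) and in that of \<open>X\<close> (\<open>c1\<close>,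
    \<open>c2\<close>).\<close>
  define b1 where "b1 v = (if v \<in> K1 then Blk2 v else Blk3 v)" for v :: 'v
  define b2 where "b2 v = (if v \<in> K2 then Blk2 v else Blk3 v)" for v :: 'v
  define c1 where "c1 v = (if v \<in> T1 G then Blk4 v else Blk5 v)" for v :: 'v
  define c2 where "c2 v = (if v \<in> T2 G then Blk4 v else Blk5 v)" for v :: 'v
  have inj: "inj b1" "inj b2" "inj c1" "inj c2"
    by (auto simp: inj_on_def b1_def b2_def c1_def c2_def split: if_splits)
  have inj_on: "inj_on b1 V" "inj_on b2 V" "inj_on c1 V" "inj_on c2 V" for V
    using inj by (auto intro: inj_on_subset)
  let ?A = "J1 \<union> E1" and ?B = "J2 \<union> E2"
  have b1_img: "b1 ` (J1 \<union> K1) = Blk2 ` K1 \<union> Blk3 ` J1"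
    using J(1) T_split(3) by (force simp: b1_def)
  have b2_img: "b2 ` (J2 \<union> K2) = Blk2 ` K2 \<union> Blk3 ` J2"
    using J(2) T_split(4) by (force simp: b2_def)
  have c1_img: "c1 ` (?A \<union> S0) = Blk4 ` J1 \<union> Blk5 ` (E1 \<union> S0)"
    using J(1) row_col_sets(1) S_split(1,3) T_disjoint(2) by (force simp: c1_def)
  have c2_img: "c2 ` (?B \<union> S0) = Blk4 ` J2 \<union> Blk5 ` (E2 \<union> S0)"
    using J(2) row_col_sets(2) S_split(2,3) T_disjoint(3) by (force simp: c2_def)
  have D_iff: "(Blk4 u, Blk3 w) \<in> D \<longleftrightarrow> u = w \<and> u \<in> U1" "(Blk3 u, Blk4 w) \<in> D \<longleftrightarrow> u = w \<and> u \<in> U2" for u w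
    by (auto simp: D_def)
  have D_other: "(Blk1 k, j) \<notin> D" "(Blk2 u, j) \<notin> D" "(Blk5 u, j) \<notin> D"
    "(Blk4 u, Blk4 w) \<notin> D" "(i, Blk1 k) \<notin> D" "(i, Blk5 w) \<notin> D" for k u w i j
    by (auto simp: D_def)
  note W_simps = W_def D_iff D_other
  have K_cases: "(\<exists>v\<in>U1. p = (Blk4 v, Blk3 v)) \<or> (\<exists>v\<in>U2. p = (Blk3 v, Blk4 v))" if "p \<in> K" for p
    using subsetD[OF K that] unfolding D_def by blast
  have K3: "p = (Blk3 v, Blk4 v)" if "p \<in> K" "fst p = Blk3 v \<or> snd p = Blk4 v" for p v
    using K_cases[OF that(1)] that(2) by auto
  have K4: "p = (Blk4 v, Blk3 v)" if "p \<in> K" "fst p = Blk4 v \<or> snd p = Blk3 v" for p v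
    using K_cases[OF that(1)] that(2) by auto
  have K_other: "fst p \<noteq> Blk1 k" "fst p \<noteq> Blk2 v" "fst p \<noteq> Blk5 v"
    "snd p \<noteq> Blk1 k" "snd p \<noteq> Blk2 v" "snd p \<noteq> Blk5 v" if "p \<in> K" for p k v
    using K_cases[OF that] by auto
  have K_image: "Blk3 v \<in> fst ` K \<longleftrightarrow> (Blk3 v, Blk4 v) \<in> K"
    "Blk4 v \<in> fst ` K \<longleftrightarrow> (Blk4 v, Blk3 v) \<in> K" "Blk3 v \<in> snd ` K \<longleftrightarrow> (Blk4 v, Blk3 v) \<in> K"
    "Blk4 v \<in> snd ` K \<longleftrightarrow> (Blk3 v, Blk4 v) \<in> K" for v
    by (metis K3 fst_conv image_iff, metis K4 fst_conv image_iff,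
        metis K4 snd_conv image_iff, metis K3 snd_conv image_iff)
  have K_image': "Blk1 k \<notin> fst ` K" "Blk2 v \<notin> fst ` K" "Blk5 v \<notin> fst ` K"
    "Blk1 k \<notin> snd ` K" "Blk2 v \<notin> snd ` K" "Blk5 v \<notin> snd ` K" for k v
    using K_other by (metis imageE)+
  have R: "R = Blk1 ` {..<r} \<union> b2 ` (J2 \<union> K2) \<union> c1 ` (?A \<union> S0)"
    unfolding b2_img c1_img
  proof (rule Set.set_eqI)
    show "i \<in> R \<longleftrightarrow> i \<in> Blk1 ` {..<r} \<union> (Blk2 ` K2 \<union> Blk3 ` J2) \<union> (Blk4 ` J1 \<union> Blk5 ` (E1 \<union> S0))" for i
      by (cases i) (auto simp: R_def Z_rows_def J1_def J2_def K_image K_image')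
  qed
  have C: "C = Blk1 ` {..<r} \<union> b1 ` (J1 \<union> K1) \<union> c2 ` (?B \<union> S0)"
    unfolding b1_img c2_img
  proof (rule Set.set_eqI)
    show "j \<in> C \<longleftrightarrow> j \<in> Blk1 ` {..<r} \<union> (Blk2 ` K1 \<union> Blk3 ` J1) \<union> (Blk4 ` J2 \<union> Blk5 ` (E2 \<union> S0))" for j
      by (cases j) (auto simp: C_def Z_cols_def J1_def J2_def K_image K_image')
  qed
  \<comment> \<open>With the diagonals cleared, each of the three nonzero blocks is alone in its
    rows and in its columns.\<close>
  have W_b1: "W i j = 0" if "j \<in> b1 ` (J1 \<union> K1)" "i \<in> R - Blk1 ` {..<r}" for i j
    using that J unfolding b1_img R b2_img c1_img by (auto simp: W_simps diag_entry_def)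
  have W_Blk1: "W i j = 0" if "j \<in> Blk1 ` {..<r}" "i \<in> R - b2 ` (J2 \<union> K2)" for i j
    using that unfolding R b2_img c1_img by (auto simp: W_simps)
  have W_c2: "W i j = 0" if "j \<in> c2 ` (?B \<union> S0)" "i \<in> R - c1 ` (?A \<union> S0)" for i j
    using that J unfolding c2_img R b2_img c1_img by (auto simp: W_simps diag_entry_def)
  have W_Blk1': "W i j = 0" if "i \<in> Blk1 ` {..<r}" "j \<in> C - b1 ` (J1 \<union> K1)" for i j
    using that unfolding C b1_img c2_img by (auto simp: W_simps)
  have W_b2': "W i j = 0" if "i \<in> b2 ` (J2 \<union> K2)" "j \<in> C - Blk1 ` {..<r}" for i j
    using that J unfolding b2_img C b1_img c2_img by (auto simp: W_simps diag_entry_def)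
  have W_c1': "W i j = 0" if "i \<in> c1 ` (?A \<union> S0)" "j \<in> C - c2 ` (?B \<union> S0)" for i j
    using that J unfolding c1_img C b1_img c2_img by (auto simp: W_simps diag_entry_def)
  have sub: "Blk1 ` {..<r} \<subseteq> R" "b2 ` (J2 \<union> K2) \<subseteq> R" "c1 ` (?A \<union> S0) \<subseteq> R"
    "Blk1 ` {..<r} \<subseteq> C" "b1 ` (J1 \<union> K1) \<subseteq> C" "c2 ` (?B \<union> S0) \<subseteq> C"
    unfolding R C by auto
  have inj_Blk1: "inj_on Blk1 {..<r}" by (simp add: inj_on_def)
  have tk1: "trivial_kernel (Blk1 ` {..<r}) (b1 ` (J1 \<union> K1)) W"
    by (rule trivial_kernel_block[OF tkW finRC(2) sub(5)]) (rule W_b1)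
  have tk2: "trivial_kernel (b2 ` (J2 \<union> K2)) (Blk1 ` {..<r}) W"
    by (rule trivial_kernel_block[OF tkW finRC(2) sub(4)]) (rule W_Blk1)
  have tk3: "trivial_kernel (c1 ` (?A \<union> S0)) (c2 ` (?B \<union> S0)) W"
    by (rule trivial_kernel_block[OF tkW finRC(2) sub(6)]) (rule W_c2)
  have tk1': "trivial_kernel (b1 ` (J1 \<union> K1)) (Blk1 ` {..<r}) (\<lambda>j i. W i j)"
    by (rule trivial_kernel_block[OF tkW' finRC(1) sub(1)]) (rule W_Blk1')
  have tk2': "trivial_kernel (Blk1 ` {..<r}) (b2 ` (J2 \<union> K2)) (\<lambda>j i. W i j)"
    by (rule trivial_kernel_block[OF tkW' finRC(1) sub(2)]) (rule W_b2')
  have tk3': "trivial_kernel (c2 ` (?B \<union> S0)) (c1 ` (?A \<union> S0)) (\<lambda>j i. W i j)"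
    by (rule trivial_kernel_block[OF tkW' finRC(1) sub(3)]) (rule W_c1')
  \<comment> \<open>A trivial kernel bounds the columns of a block by its rows, and that of the
    transpose gives the converse: all three blocks are square.\<close>
  have card1: "card (J1 \<union> K1) = r"
    using card_le_of_trivial_kernel[OF _ _ tk1] card_le_of_trivial_kernel[OF _ _ tk1']
    by (simp add: card_image[OF inj_on(1)] card_image[OF inj_Blk1])
  have card2: "card (J2 \<union> K2) = r"
    using card_le_of_trivial_kernel[OF _ _ tk2] card_le_of_trivial_kernel[OF _ _ tk2']
    by (simp add: card_image[OF inj_on(2)] card_image[OF inj_Blk1])
  have card3: "card (?A \<union> S0) = card (?B \<union> S0)"
    using card_le_of_trivial_kernel[OF _ _ tk3] card_le_of_trivial_kernel[OF _ _ tk3']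
    by (simp add: card_image[OF inj_on(3)] card_image[OF inj_on(4)])
  have "trivial_kernel {..<r} (J1 \<union> K1) (\<lambda>i v. const (Q1 i v) :: ('x, 'f) ratfun)"
    using tk1 by (subst (asm) trivial_kernel_image[OF inj_on(1)])
      (auto simp: W_simps b1_def)
  then have "trivial_kernel {..<r} (J1 \<union> K1) Q1" by (rule trivial_kernel_const)
  then have indep1: "J1 \<union> K1 \<in> indep (MM1 G)"
    using indep_iff1 J(1) row_col_sets(1,3) by simp
  have "trivial_kernel {..<r} (J2 \<union> K2) (\<lambda>j v. const (Q2 v j) :: ('x, 'f) ratfun)"
    using tk2' by (subst (asm) trivial_kernel_image[OF inj_on(2)])
      (auto simp: W_simps b2_def)
  then have "trivial_kernel {..<r} (J2 \<union> K2) (\<lambda>j v. Q2 v j)" by (rule trivial_kernel_const)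
  then have indep2: "J2 \<union> K2 \<in> indep (MM2 G)"
    using indep_iff2 J(2) row_col_sets(2,4) by simp
  have "trivial_kernel (?A \<union> S0) (?B \<union> S0) X"
    using tk3 by (subst (asm) trivial_kernel_image[OF inj_on(4)])
      (auto simp: W_simps c1_def c2_def)
  then have nsX: "nonsingular (?A \<union> S0) (?B \<union> S0) X"
    using card3 by (simp add: nonsingular_iff_trivial_kernel)
  have AB: "?A \<subseteq> T1 H" "?B \<subseteq> T2 H" using J by auto
  have disj: "?A \<inter> ?B = {}" "?A \<inter> S0 = {}" "?B \<inter> S0 = {}"
    using AB H_disjoint by auto
  have "\<exists>P N. path_system (EE H) ?A ?B S0 P N"
  proof (rule ex_path_system_of_nonsingular[OF nsX disj])
    show "{a, b} \<in> EE H" if "a \<in> ?A \<union> S0" "b \<in> ?B \<union> S0" "X a b \<noteq> 0" for a b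
    proof -
      have ab: "a \<in> U1 \<union> E1 \<union> S0" "b \<in> U2 \<union> E2 \<union> S0" using that(1,2) J by auto
      then have "a \<in> T1 G \<union> SS G" "b \<in> T2 G \<union> SS G" using S_split(1-3) row_col_sets(1,2) by blast+
      then have "{a, b} \<in> EE G" using X_entry(2) that(3) by blast
      then show ?thesis using E'I ab by simp
    qed
    show "X b a = - X a b" if "a \<in> S0" "b \<in> S0" for a b
      using S_split(3) that by (intro X_skew) auto
    show "X a a = 0" if "a \<in> S0" for a using S_split(3) that by (intro X_diag) auto
    show "card e = 2" if "e \<in> EE H" for e using that E'_subset card_edge by auto
  qed
  then obtain P N where PN: "path_system (EE H) ?A ?B S0 P N" by blast
  note pm = path_matching_of_path_system[OF PN disj refl AB contract_simps(3)[symmetric] H_disjoint]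
  have "matroid_basis (MM1 H) ?A" "matroid_basis (MM2 H) ?B"
    unfolding basis_contract1 basis_contract2 using J indep1 indep2 card1 card2 by blast+
  then have "bpm H (system_edges P N)" unfolding bpm_def using pm by simp
  then show ?thesis by blast
qed

subsection \<open>From a basic path-matching to nonsingularity\<close>

lemma nonsingular_if_bpm:
  assumes "bpm H N0"
  shows "nonsingular (Z_rows G r M) (Z_cols G r M) (Z_entry Q1 Q2 d X)"
proof -
  obtain P N where PN: "path_system (EE H) (covered (T1 H) N0) (covered (T2 H) N0) S0 P N"
    and N0: "N0 = system_edges P N"
    using path_system_of_path_matching[of H N0] assms H_disjoint
    unfolding bpm_def contract_simps(3) by blast
  obtain J1 where J1: "covered (T1 H) N0 = J1 \<union> E1" "J1 \<subseteq> U1" "J1 \<union> K1 \<in> indep (MM1 G)"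
    "card (J1 \<union> K1) = r"
    using assms unfolding bpm_def basis_contract1 by blast
  obtain J2 where J2: "covered (T2 H) N0 = J2 \<union> E2" "J2 \<subseteq> U2" "J2 \<union> K2 \<in> indep (MM2 G)"
    "card (J2 \<union> K2) = r"
    using assms unfolding bpm_def basis_contract2 by blast
  let ?A = "J1 \<union> E1" and ?B = "J2 \<union> E2"
  have sys: "path_system (EE H) ?A ?B S0 P N" using PN J1(1) J2(1) by simp
  have AB: "?A \<subseteq> T1 H" "?B \<subseteq> T2 H" using J1(2) J2(2) by auto
  have disj: "?A \<inter> ?B = {}" "?A \<inter> S0 = {}" "?B \<inter> S0 = {}"
    using AB H_disjoint by auto
  have finJ [simp]: "finite J1" "finite J2"
    using finite_subset[OF J1(2)] finite_subset[OF J2(2)] by simp_all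
  define K where "K = system_edges P N"
  have K_sub: "K \<subseteq> EE G"
  proof -
    have "K \<subseteq> EE H"
      using path_system_path(1)[OF sys] path_system_matching(1)[OF sys]
      unfolding K_def system_edges_def is_path_def by blast
    then show ?thesis using E'_subset by simp
  qed
  \<comment> \<open>For a vertex outside \<open>J1\<close> and \<open>J2\<close> the diagonal entry
    becomes 1 and pairs its row with its column. This leaves exactly the blocks indexed by the two
    bases and by the ends of the paths.\<close>
  define U where "U = x ` K \<union> d ` (U1 - J1 \<union> (U2 - J2))"
  have U_x: "x e \<in> U \<longleftrightarrow> e \<in> K" if e: "e \<in> EE G" for e
  proof -
    have "x e \<notin> d ` (U1 \<union> U2)" using x_d_disjoint e by blast
    then have "x e \<notin> d ` (U1 - J1 \<union> (U2 - J2))" by blast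
    then show ?thesis unfolding U_def using inj_on_image_mem_iff[OF inj_x e K_sub] by simp
  qed
  have U_d: "d u \<in> U \<longleftrightarrow> u \<in> U1 - J1 \<union> (U2 - J2)" if u: "u \<in> U1 \<union> U2" for u
  proof -
    have "d u \<notin> x ` EE G" using x_d_disjoint u by blast
    then have "d u \<notin> x ` K" using K_sub by blast
    moreover have "U1 - J1 \<union> (U2 - J2) \<subseteq> U1 \<union> U2" by blast
    ultimately show ?thesis unfolding U_def using inj_on_image_mem_iff[OF inj_d u] by simp
  qed
  have U12: "U1 \<inter> U2 = {}" using T_disjoint(1) row_col_sets(1,2) by blast
  have U_d1: "d u \<in> U \<longleftrightarrow> u \<notin> J1" if "u \<in> U1" for u using U_d[of u] that U12 by blast
  have U_d2: "d u \<in> U \<longleftrightarrow> u \<notin> J2" if "u \<in> U2" for u using U_d[of u] that U12 by blast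
  define Y where "Y a b = spec_frac U (X a b)" for a b
  have Y: "Y a b \<noteq> 0 \<longleftrightarrow> {a, b} \<in> K" if "a \<in> T1 G \<union> SS G" "b \<in> T2 G \<union> SS G" for a b
  proof (cases "{a, b} \<in> EE G")
    case True
    then show ?thesis using X_entry(1)[OF that True] U_x[OF True] by (auto simp: Y_def)
  next
    case False
    then show ?thesis using X_entry(2)[OF that False] K_sub by (auto simp: Y_def)
  qed
  have sets: "?A \<union> S0 \<subseteq> T1 G \<union> SS G" "?B \<union> S0 \<subseteq> T2 G \<union> SS G"
    using J1(2) J2(2) row_col_sets(1,2) S_split(1-3) by blast+
  have tkY: "trivial_kernel (?A \<union> S0) (?B \<union> S0) Y"
  proof (rule trivial_kernel_path_system[OF sys disj])
    show "card e = 2" if "e \<in> N" for e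
      using that K_sub card_edge by (auto simp: K_def system_edges_def)
    show "Y a b \<noteq> 0 \<longleftrightarrow> {a, b} \<in> system_edges P N" if "a \<in> ?A \<union> S0" "b \<in> ?B \<union> S0" for a b
      using Y[of a b] that sets unfolding K_def by blast
  qed simp_all
  have tk1: "trivial_kernel {..<r} (J1 \<union> K1) Q1"
    using J1(3) by (subst indep_iff1[symmetric]) (use J1(2) row_col_sets in auto)
  \<comment> \<open>Independence concerns the rows of \<open>Q2\<close>. The block is square because
    \<open>J2 \<union> K2\<close> is a basis, so it may be transposed.\<close>
  have tk2: "trivial_kernel (J2 \<union> K2) {..<r} Q2"
  proof -
    have "trivial_kernel {..<r} (J2 \<union> K2) (\<lambda>j u. Q2 u j)"
      using J2(3) by (subst indep_iff2[symmetric]) (use J2(2) row_col_sets in auto)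
    then have "nonsingular {..<r} (J2 \<union> K2) (\<lambda>j u. Q2 u j)"
      using J2(4) by (simp add: nonsingular_iff_trivial_kernel)
    from nonsingular_trivial_kernel[OF nonsingular_transpose[OF this]] show ?thesis .
  qed
  show ?thesis
  proof (rule nonsingular_if_spec_frac[of _ _ U])
    have fin: "finite (Z_rows G r M)" "finite (Z_cols G r M)"
      by (simp_all add: Z_rows_def Z_cols_def)
    \<comment> \<open>Both bases have \<open>r\<close> elements and there are as many path starts as
      path ends; thus \<open>card K2 + card E1\<close> equals
      \<open>card K1 + card E2\<close>.\<close>
    have "card (Z_rows G r M) = card (Z_cols G r M)"
    proof -
      have c1: "card K1 + card U1 = t" "card K2 + card U2 = t"
        using card_T T_split card_Un_disjoint[of K1 U1] card_Un_disjoint[of K2 U2] by simp_all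
      have "J1 \<inter> K1 = {}" "J2 \<inter> K2 = {}" using J1(2) J2(2) T_split(3,4) by auto
      then have c2: "card J1 + card K1 = r" "card J2 + card K2 = r"
        using J1(4) J2(4) by (simp_all add: card_Un_disjoint)
      have "J1 \<inter> E1 = {}" "J2 \<inter> E2 = {}"
        using J1(2) J2(2) row_col_sets(1,2) S_split(1,2) T_disjoint(2,3) by blast+
      then have c3: "card J1 + card E1 = card J2 + card E2"
        using card_path_system[OF sys disj] by (simp add: card_Un_disjoint)
      have "card (Z_rows G r M) = r + card K2 + card U2 + card U1 + (card E1 + card S0)"
        "card (Z_cols G r M) = r + card K1 + card U1 + card U2 + (card E2 + card S0)"
        unfolding Z_rows_def Z_cols_def using S_split(5,6)
        by (simp_all add: card_blocks card_Un_disjoint)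
      then show ?thesis using c1 c2 c3 by simp
    qed
    moreover have "trivial_kernel (Z_rows G r M) (Z_cols G r M)
        (\<lambda>i j. spec_frac U (Z_entry Q1 Q2 d X i j))"
    proof (rule trivial_kernelI)
      fix v assume v: "\<And>i. i \<in> Z_rows G r M \<Longrightarrow>
        (\<Sum>j\<in>Z_cols G r M. spec_frac U (Z_entry Q1 Q2 d X i j) * v j) = 0"
      note sum_cols = sum_blocks[OF finite_lessThan finite_parts(1,3,4) finite_UnI[OF finite_parts(6,7)]]
      have diag: "(\<Sum>w\<in>V. spec_frac U (diag_entry d u w) * f w) = (if d u \<in> U then f u else 0)"
        if "u \<in> V" "finite V" for u V and f :: "'v \<Rightarrow> 'f"
      proof -
        have "(\<Sum>w\<in>V. spec_frac U (diag_entry d u w) * f w) =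
            (\<Sum>w\<in>V. if u = w then (if d u \<in> U then f u else 0) else 0)"
          by (rule sum.cong) (auto simp: diag_entry_def)
        then show ?thesis using that by simp
      qed
      have row_mem: "i < r \<Longrightarrow> Blk1 i \<in> Z_rows G r M" "u \<in> K2 \<Longrightarrow> Blk2 u \<in> Z_rows G r M"
        "u \<in> U2 \<Longrightarrow> Blk3 u \<in> Z_rows G r M" "u \<in> U1 \<Longrightarrow> Blk4 u \<in> Z_rows G r M"
        "u \<in> E1 \<union> S0 \<Longrightarrow> Blk5 u \<in> Z_rows G r M" for i u
        by (auto simp: Z_rows_def)
      have row1: "(\<Sum>u\<in>K1. Q1 i u * v (Blk2 u)) + (\<Sum>u\<in>U1. Q1 i u * v (Blk3 u)) = 0" if "i < r" for i
        using v[OF row_mem(1)[OF that]] by (simp add: Z_cols_def sum_cols)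
      have row2: "(\<Sum>j<r. Q2 u j * v (Blk1 j)) = 0" if "u \<in> K2" for u
        using v[OF row_mem(2)[OF that]] by (simp add: Z_cols_def sum_cols)
      have row3: "(\<Sum>j<r. Q2 u j * v (Blk1 j)) + (if u \<in> J2 then 0 else v (Blk4 u)) = 0" if "u \<in> U2" for u
        using v[OF row_mem(3)[OF that]] U_d2[OF that] that
        by (cases "u \<in> J2") (simp_all add: Z_cols_def sum_cols diag)
      have row4: "(if u \<in> J1 then 0 else v (Blk3 u)) + (\<Sum>w\<in>U2. Y u w * v (Blk4 w)) +
          (\<Sum>w\<in>E2 \<union> S0. Y u w * v (Blk5 w)) = 0" if "u \<in> U1" for u
        using v[OF row_mem(4)[OF that]] U_d1[OF that] that
        by (cases "u \<in> J1") (simp_all add: Z_cols_def sum_cols diag Y_def)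
      have row5: "(\<Sum>w\<in>U2. Y u w * v (Blk4 w)) + (\<Sum>w\<in>E2 \<union> S0. Y u w * v (Blk5 w)) = 0"
        if "u \<in> E1 \<union> S0" for u
        using v[OF row_mem(5)[OF that]] by (simp add: Z_cols_def sum_cols Y_def)
      \<comment> \<open>In the rows of \<open>J2 \<union> K2\<close> nothing of \<open>D2\<close>
        survives, so they contain only the square nonsingular block of \<open>Q2\<close>.\<close>
      have v1: "v (Blk1 j) = 0" if "j < r" for j
      proof -
        have "(\<Sum>j<r. Q2 u j * v (Blk1 j)) = 0" if "u \<in> J2 \<union> K2" for u
          using row2[of u] row3[of u] that J2(2) by (auto split: if_splits)
        then show ?thesis
          using trivial_kernelD[OF tk2, of "\<lambda>j. v (Blk1 j)" j] \<open>j < r\<close> by simp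
      qed
      \<comment> \<open>With the first column block gone, each remaining row of \<open>D2\<close>
        consists of a single diagonal entry 1.\<close>
      have v4': "v (Blk4 u) = 0" if "u \<in> U2 - J2" for u
        using row3[of u] that v1 by simp
      define y where "y w = (if w \<in> T2 G then v (Blk4 w) else v (Blk5 w))" for w
      have y4: "y w = v (Blk4 w)" if "w \<in> U2" for w
        using that row_col_sets(2) by (auto simp: y_def)
      have y5: "y w = v (Blk5 w)" if "w \<in> E2 \<union> S0" for w
        using that S_split(2,3) T_disjoint(3) by (auto simp: y_def)
      \<comment> \<open>The columns of \<open>U2 - J2\<close> contribute nothing by
        \<open>v4'\<close>, so the rows of \<open>Z\<close> reduce to the block of \<open>Y\<close>
        controlled by \<open>tkY\<close>.\<close>
      have ysum: "(\<Sum>w\<in>?B \<union> S0. Y u w * y w) =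
          (\<Sum>w\<in>U2. Y u w * v (Blk4 w)) + (\<Sum>w\<in>E2 \<union> S0. Y u w * v (Blk5 w))" for u
      proof -
        have "J2 \<inter> (E2 \<union> S0) = {}"
          using J2(2) row_col_sets(2) S_split(2,3) T_disjoint(3) by blast
        then have "(\<Sum>w\<in>J2 \<union> (E2 \<union> S0). Y u w * y w) =
            (\<Sum>w\<in>J2. Y u w * y w) + (\<Sum>w\<in>E2 \<union> S0. Y u w * y w)"
          by (intro sum.union_disjoint) simp_all
        moreover have "(\<Sum>w\<in>J2. Y u w * y w) = (\<Sum>w\<in>U2. Y u w * v (Blk4 w))"
          by (rule sum.mono_neutral_cong_left) (use J2(2) v4' y4 in auto)
        moreover have "(\<Sum>w\<in>E2 \<union> S0. Y u w * y w) = (\<Sum>w\<in>E2 \<union> S0. Y u w * v (Blk5 w))"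
          by (rule sum.cong) (use y5 in auto)
        ultimately show ?thesis by (simp only: Un_assoc)
      qed
      have "(\<Sum>w\<in>?B \<union> S0. Y u w * y w) = 0" if u: "u \<in> ?A \<union> S0" for u
      proof (cases "u \<in> J1")
        case True
        then show ?thesis unfolding ysum using row4[of u] J1(2) by auto
      next
        case False
        then have "u \<in> E1 \<union> S0" using u by blast
        then show ?thesis unfolding ysum by (rule row5)
      qed
      then have y0: "y w = 0" if "w \<in> ?B \<union> S0" for w using trivial_kernelD[OF tkY] that by blast
      have v4: "v (Blk4 w) = 0" if "w \<in> U2" for w
        using v4'[of w] y0[of w] y4[OF that] that by (cases "w \<in> J2") auto
      have v5: "v (Blk5 w) = 0" if "w \<in> E2 \<union> S0" for w
        using y0[of w] y5[OF that] that by auto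
      \<comment> \<open>Now that the columns of \<open>X\<close> are settled, the rows of
        \<open>U1 - J1\<close> retain only their diagonal entry 1.\<close>
      have v3': "v (Blk3 u) = 0" if "u \<in> U1 - J1" for u
        using row4[of u] that v4 v5 by simp
      define q where "q u = (if u \<in> K1 then v (Blk2 u) else v (Blk3 u))" for u
      have q2: "q u = v (Blk2 u)" if "u \<in> K1" for u using that by (simp add: q_def)
      have q3: "q u = v (Blk3 u)" if "u \<in> U1" for u using that T_split(3) by (auto simp: q_def)
      \<comment> \<open>What is left of the first row block is \<open>Q1\<close> on the basis
        \<open>J1 \<union> K1\<close>.\<close>
      have "(\<Sum>u\<in>J1 \<union> K1. Q1 i u * q u) = 0" if "i < r" for i
      proof -
        have "J1 \<inter> K1 = {}" using J1(2) T_split(3) by blast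
        then have "(\<Sum>u\<in>J1 \<union> K1. Q1 i u * q u) = (\<Sum>u\<in>J1. Q1 i u * q u) + (\<Sum>u\<in>K1. Q1 i u * q u)"
          by (intro sum.union_disjoint) simp_all
        moreover have "(\<Sum>u\<in>J1. Q1 i u * q u) = (\<Sum>u\<in>U1. Q1 i u * v (Blk3 u))"
          by (rule sum.mono_neutral_cong_left) (use J1(2) v3' q3 in auto)
        moreover have "(\<Sum>u\<in>K1. Q1 i u * q u) = (\<Sum>u\<in>K1. Q1 i u * v (Blk2 u))"
          by (rule sum.cong) (use q2 in auto)
        ultimately show ?thesis using row1[OF that] by (simp add: add.commute)
      qed
      then have q0: "q u = 0" if "u \<in> J1 \<union> K1" for u
        using trivial_kernelD[OF tk1, of q] that by blast
      have v2: "v (Blk2 u) = 0" if "u \<in> K1" for u using q0[of u] q2[OF that] that by simp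
      have v3: "v (Blk3 u) = 0" if "u \<in> U1" for u
        using v3'[of u] q0[of u] q3[OF that] that by (cases "u \<in> J1") auto
      show "\<forall>j\<in>Z_cols G r M. v j = 0"
        unfolding Z_cols_def using v1 v2 v3 v4 v5 by auto
    qed
    ultimately show "nonsingular (Z_rows G r M) (Z_cols G r M)
        (\<lambda>i j. spec_frac U (Z_entry Q1 Q2 d X i j))"
      using fin nonsingular_iff_trivial_kernel by blast
  next
    fix i j assume i: "i \<in> Z_rows G r M" and j: "j \<in> Z_cols G r M"
    have X_range: "X a b \<in> range to_fract"
      if "a \<in> U1 \<or> a \<in> E1 \<or> a \<in> S0" "b \<in> U2 \<or> b \<in> E2 \<or> b \<in> S0" for a b
    proof -
      have "a \<in> T1 G \<union> SS G" "b \<in> T2 G \<union> SS G"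
        using that row_col_sets(1,2) S_split(1-3) by blast+
      then show ?thesis using X_entry[of a b] by (cases "{a, b} \<in> EE G") auto
    qed
    have diag_range: "(diag_entry d u w :: ('x, 'f) ratfun) \<in> range to_fract" for u w
      by (simp add: diag_entry_def)
    from i j show "Z_entry Q1 Q2 d X i j \<in> range to_fract"
      unfolding Z_rows_def Z_cols_def
      by (cases i; cases j) (auto intro: X_range simp: diag_range)
  qed
qed

end

theorem mainTheorem4:
  fixes G :: "'v bpm_inst" and t r :: nat
    and Q1 :: "nat \<Rightarrow> 'v \<Rightarrow> 'f::field" and Q2 :: "'v \<Rightarrow> nat \<Rightarrow> 'f"
    and M :: "'v set set"
    and x :: "'v set \<Rightarrow> 'x::linorder" and d :: "'v \<Rightarrow> 'x"
    and X :: "'v \<Rightarrow> 'v \<Rightarrow> ('x, 'f) ratfun"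
  assumes "bpm_instance t r G"
    and "represents r (\<lambda>v i. Q1 i v) (MM1 G)"
    and "represents r (\<lambda>v j. Q2 v j) (MM2 G)"
    and "M \<subseteq> EE G"
    and "cov1 G M \<in> indep (MM1 G)"
    and "cov2 G M \<in> indep (MM2 G)"
    and "inj_on x (EE G)"
    and "inj_on d (unc1 G M \<union> unc2 G M)"
    and "x ` EE G \<inter> d ` (unc1 G M \<union> unc2 G M) = {}"
    and "is_X_matrix G x X"
  shows "(\<exists>N. bpm (contract G M) N) \<longleftrightarrow>
           nonsingular (Z_rows G r M) (Z_cols G r M) (Z_entry Q1 Q2 d X)"
proof -
  interpret contraction G t r Q1 Q2 M x d X
    using assms by unfold_locales
  show ?thesis using ex_bpm_if_nonsingular nonsingular_if_bpm by blast
qed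

end
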